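(* Suppose $M/K$ is obtained by general normal magnification from $L/K$ through $J/K$. (1) Let the unique normal descending chain for $L/K$ be $L=N_0\supsetneq N_1\supsetneq\dots\supsetneq N_k$ and the unique normal descending chain for $J/K$ be $J=N'_0\supsetneq N'_1\supsetneq\dots\supsetneq N'_{k'}$. Then the unique normal descending chain for $M/K$ is $$M=N_0N'_0\supsetneq N_1N'_1\supsetneq\dots\supsetneq N_{k'}N'_{k'}\supsetneq N_{k'+1}N'_{k'}\supsetneq\dots\supsetneq N_kN'_{k'}$$ if $k\ge k'$, and $$M=N_0N'_0\supsetneq N_1N'_1\supsetneq\dots\supsetneq N_kN'_k\supsetneq N_kN'_{k+1}\supsetneq\dots\supsetneq N_kN'_{k'}$$ if $k<k'$. (2) Let the unique normal ascending chain for $L/K$ be $K=F_0\subsetneq F_1\subsetneq\dots\subsetneq F_l$ and the unique normal ascending chain for $J/K$ be $K=F'_0\subsetneq F'_1\subsetneq\dots\subsetneq F'_{l'}$. Then the unique normal ascending chain for $M/K$ is $$K=F_0F'_0\subsetneq F_1F'_1\subsetneq\dots\subsetneq F_{l'}F'_{l'}\subsetneq F_{l'+1}F'_{l'}\subsetneq\dots\subsetneq F_lF'_{l'}$$ if $l\ge l'$, and $$K=F_0F'_0\subsetneq F_1F'_1\subsetneq\dots\subsetneq F_lF'_l\subsetneq F_lF'_{l+1}\subsetneq\dots\subsetneq F_lF'_{l'}$$ if $l<l'$.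
   Context: $K$ is any field (not necessarily perfect) with a fixed algebraic closure $\bar K$; all extensions are finite and contained in $\bar K$. A finite extension $M/K$ is obtained by general normal magnification from a subextension $L/K$ through a finite extension $J/K$ if $[L:K]>1$, the normal closures $\tilde L,\tilde J$ of $L/K,J/K$ in $\bar K$ are linearly disjoint over $K$, and $LJ=M$. For a finite extension $E/K$ there is a unique intermediate field $N$ such that $E/N$ is normal of maximum possible degree, and a unique largest normal subextension of $E/K$. The unique normal descending chain for $E/K$ is the strictly descending chain $E=N_0\supsetneq N_1\supsetneq\dots\supsetneq N_k$ in which $N_i$ is the unique intermediate field of $N_{i-1}/K$ with $N_{i-1}/N_i$ normal of maximum possible degree, continued until it stabilizes (so $N_k/N$ is normal with $K\subset N\subset N_k$ only for $N=N_k$). The unique normal ascending chain for $E/K$ is the strictly ascending chain $K=F_0\subsetneq F_1\subsetneq\dots\subsetneq F_l$ in which $F_j$ is the largest normal subextension of $E/F_{j-1}$, continued until it stabilizes (so the largest normal subextension of $E/F_l$ is $F_l$). Chains may consist of a single field. *)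

theory Defs
  imports "HOL-Algebra.Algebraic_Closure" "HOL-Algebra.Generated_Fields"
begin

text \<open>
  All fields are subfields of one ambient field \<open>R\<close>; in the theorem this is the fixed
  algebraic closure of the base field.
\<close>

context ring
begin

definition intermediate_field :: "'a set \<Rightarrow> 'a set \<Rightarrow> 'a set \<Rightarrow> bool"
  where "intermediate_field K E N \<longleftrightarrow> subfield N R \<and> K \<subseteq> N \<and> N \<subseteq> E"

definition finite_field_ext :: "'a set \<Rightarrow> 'a set \<Rightarrow> bool"
  where "finite_field_ext K E \<longleftrightarrow>
    subfield K R \<and> subfield E R \<and> K \<subseteq> E \<and> finite_dimension K E"

text \<open>
  The field \<open>E\<close> is normal over \<open>K\<close> if it is algebraic and every irreducible polynomial over \<open>K\<close>
  with a root in \<open>E\<close> splits in \<open>E[X]\<close>. Splitting is expressed by \<^const>\<open>ring.splitted\<close> in the ring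
  \<open>E\<close> itself: the library's \<open>splitted_on\<close> intersects with \<open>mset_set E\<close>, so it loses root
  multiplicities (hence is wrong for inseparable polynomials) and is useless for infinite \<open>E\<close>.
\<close>

definition normal_ext :: "'a set \<Rightarrow> 'a set \<Rightarrow> bool"
  where "normal_ext K E \<longleftrightarrow>
    subfield K R \<and> subfield E R \<and> K \<subseteq> E \<and>
    (\<forall>x \<in> E. (algebraic over K) x) \<and>
    (\<forall>p \<in> carrier (K[X]). pirreducible K p \<and> (\<exists>x \<in> E. eval p x = \<zero>)
       \<longrightarrow> ring.splitted (R \<lparr> carrier := E \<rparr>) p)"

definition normal_closure :: "'a set \<Rightarrow> 'a set \<Rightarrow> 'a set"
  where "normal_closure K E = \<Inter> { N. normal_ext K N \<and> E \<subseteq> N }"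

text \<open>Every family in \<open>A\<close> that is linearly independent over \<open>K\<close> stays so over \<open>B\<close>.\<close>

definition linearly_disjoint :: "'a set \<Rightarrow> 'a set \<Rightarrow> 'a set \<Rightarrow> bool"
  where "linearly_disjoint K A B \<longleftrightarrow>
    (\<forall>Us. set Us \<subseteq> A \<and> independent K Us \<longrightarrow> independent B Us)"

definition compositum :: "'a set \<Rightarrow> 'a set \<Rightarrow> 'a set"
  where "compositum A B = generate_field R (A \<union> B)"

definition general_normal_magnification :: "'a set \<Rightarrow> 'a set \<Rightarrow> 'a set \<Rightarrow> 'a set \<Rightarrow> bool"
  where "general_normal_magnification K L J M \<longleftrightarrow>
    finite_field_ext K M \<and> finite_field_ext K L \<and> L \<subseteq> M \<and> finite_field_ext K J \<and>
    (dim over K) L > 1 \<and>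
    linearly_disjoint K (normal_closure K L) (normal_closure K J) \<and>
    compositum L J = M"

definition max_normal_over :: "'a set \<Rightarrow> 'a set \<Rightarrow> 'a set \<Rightarrow> bool"
  where "max_normal_over K E N \<longleftrightarrow>
    intermediate_field K E N \<and> normal_ext N E \<and>
    (\<forall>N'. intermediate_field K E N' \<and> normal_ext N' E \<longrightarrow> (dim over N') E \<le> (dim over N) E)"

definition unique_max_normal_over :: "'a set \<Rightarrow> 'a set \<Rightarrow> 'a set \<Rightarrow> bool"
  where "unique_max_normal_over K E N \<longleftrightarrow>
    max_normal_over K E N \<and> (\<forall>N'. max_normal_over K E N' \<longrightarrow> N' = N)"

definition largest_normal_subext :: "'a set \<Rightarrow> 'a set \<Rightarrow> 'a set \<Rightarrow> bool"
  where "largest_normal_subext K E F \<longleftrightarrow>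
    intermediate_field K E F \<and> normal_ext K F \<and>
    (\<forall>F'. intermediate_field K E F' \<and> normal_ext K F' \<longrightarrow> F' \<subseteq> F)"

text \<open>
  In both definitions below the chain consists of the values of the sequence at \<open>0, \<dots>, k\<close>;
  later values are irrelevant.
\<close>

definition normal_descending_chain :: "'a set \<Rightarrow> 'a set \<Rightarrow> nat \<Rightarrow> (nat \<Rightarrow> 'a set) \<Rightarrow> bool"
  where "normal_descending_chain K E k N \<longleftrightarrow>
    N 0 = E \<and>
    (\<forall>i < k. N (Suc i) \<subset> N i \<and> unique_max_normal_over K (N i) (N (Suc i))) \<and>
    (\<forall>N'. intermediate_field K (N k) N' \<and> normal_ext N' (N k) \<longrightarrow> N' = N k)"

definition normal_ascending_chain :: "'a set \<Rightarrow> 'a set \<Rightarrow> nat \<Rightarrow> (nat \<Rightarrow> 'a set) \<Rightarrow> bool"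
  where "normal_ascending_chain K E k F \<longleftrightarrow>
    F 0 = K \<and>
    (\<forall>j < k. F j \<subset> F (Suc j) \<and> largest_normal_subext (F j) E (F (Suc j))) \<and>
    largest_normal_subext (F k) E (F k)"

end

end

theory Submission
  imports Defs
begin

text \<open>
  Over the algebraic closure, \<open>E\<close> is normal over \<open>A\<close> iff every automorphism fixing \<open>A\<close> maps \<open>E\<close>
  into itself. The key fact is that stability of \<open>E\<close> over \<open>A\<close> and over \<open>B\<close> implies stability over
  \<open>A \<inter> B\<close>: for \<open>x \<in> E\<close> the product of \<open>X - y\<close> over the conjugates \<open>y \<in> E\<close> of \<open>x\<close> over \<open>A \<inter> B\<close> has
  coefficients \<open>c\<close> fixed by both groups; then some power of \<open>X - c\<close> lies in \<open>A[X]\<close> and some power in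
  \<open>B[X]\<close>, hence a common power in \<open>(A \<inter> B)[X]\<close>, so \<open>c\<close> is fixed over \<open>A \<inter> B\<close>. No separability enters.

  Linear disjointness of the normal closures \<open>P\<close> and \<open>Q\<close> of \<open>L\<close> and \<open>J\<close> gives \<open>AB \<inter> P = A\<close> for \<open>A \<subseteq> P\<close> and
  \<open>B \<subseteq> Q\<close>. If \<open>AB\<close> is normal over \<open>N\<close>, then automorphisms over \<open>N\<close> map \<open>A\<close> into \<open>AB \<inter> P = A\<close>, so \<open>A\<close> is
  normal over \<open>N \<inter> A\<close>, and symmetrically for \<open>B\<close>; this settles descending chains. For ascending chains
  let \<open>G \<subseteq> LJ\<close> be normal over \<open>AB\<close>. The coordinates in \<open>L\<close> of an element of \<open>G\<close> with respect to a
  \<open>K\<close>-basis of \<open>J\<close> stay in \<open>L\<close> under all automorphisms over \<open>AJ\<close>, and the elements of \<open>L\<close> with this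
  property form a field stable over \<open>AJ\<close> and over \<open>L\<close>, hence normal over \<open>AJ \<inter> L = A\<close>. So \<open>G \<subseteq> FJ\<close> with
  \<open>F\<close> the largest normal subextension of \<open>L/A\<close>; repeating this with the roles exchanged gives \<open>G \<subseteq> FF'\<close>.
\<close>

section \<open>Subfields and splitting\<close>

lemma (in field) subfield_Inter:
  assumes "S \<noteq> {}" and "\<And>A. A \<in> S \<Longrightarrow> subfield A R"
  shows "subfield (\<Inter>S) R"
proof (rule subfieldI')
  show "subring (\<Inter>S) R"
    using subring_Inter assms subfieldE(1) by metis
  show "inv k \<in> \<Inter>S" if "k \<in> \<Inter>S - {\<zero>}" for k
    using subfield_m_inv(1)[OF assms(2)] that by blast
qed

lemma (in field) subfield_Int:
  assumes "subfield A R" "subfield B R"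
  shows "subfield (A \<inter> B) R"
  using subfield_Inter[of "{A, B}"] assms by auto

text \<open>The inverse of \<open>x\<close> already lies in \<open>K[x]\<close>, which is a field
  because \<open>x\<close> is algebraic and which is contained in \<open>S\<close>.\<close>

lemma (in field) subring_algebraic_imp_subfield:
  assumes "subfield K R" "subring S R" "K \<subseteq> S" "\<And>x. x \<in> S \<Longrightarrow> (algebraic over K) x"
  shows "subfield S R"
proof (rule subfieldI'[OF assms(2)])
  fix x assume x: "x \<in> S - {\<zero>}"
  have xc: "x \<in> carrier R" using x subringE(1)[OF assms(2)] by blast
  have "subfield (simple_extension K x) R"
    using simple_extension_is_subfield[OF assms(1) xc] assms(4) x by blast
  moreover have "x \<in> simple_extension K x"
    using simple_extension_mem[OF subfieldE(1)[OF assms(1)] xc] .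
  moreover have "simple_extension K x \<subseteq> S"
    using simple_extension_subring_incl[OF assms(2,3)] x by blast
  ultimately show "inv x \<in> S"
    using subfield_m_inv(1) x by blast
qed

text \<open>The minimal polynomial of \<open>y\<close> over \<open>E\<close> divides
  \<open>p\<close>, and splitting forces it to be linear; hence \<open>y\<close> is minus its
  constant coefficient.\<close>

lemma (in field) splitted_in_subfield_imp_roots_in:
  assumes E: "subfield E R" and p: "p \<in> carrier (E[X])" "p \<noteq> []"
    and s: "ring.splitted (R \<lparr> carrier := E \<rparr>) p"
    and y: "y \<in> carrier R" "eval p y = \<zero>"
  shows "y \<in> E"
proof -
  interpret E: field "R \<lparr> carrier := E \<rparr>" using subfield_iff(2)[OF E] .
  note cons = univ_poly_consistent[OF subfieldE(1)[OF E]]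
  have alg: "(algebraic over E) y" using algebraicI[OF p y(2)] .
  note Irr = IrrE[OF E y(1) alg]
  have div: "Irr E y divides\<^bsub>E[X]\<^esub> p"
    using Irr_minimal[OF E y(1) alg p(1) y(2)] pdivides_iff_shell[OF E Irr(1) p(1)] by blast
  have "degree (Irr E y) = 1"
    using E.splitted_imp_trivial_factors[of p "Irr E y"] p s Irr div
    by (simp add: cons pdivides_def)
  then obtain b where b: "b \<in> E" "Irr E y = [\<one>, b]"
    using Irr(1,3) by (auto elim!: degree_oneE)
  have bc: "b \<in> carrier R" using b(1) subfieldE(3)[OF E] by blast
  have "y \<oplus> b = \<zero>" using Irr(4) b bc y(1) by simp
  hence "y = \<ominus> b" using bc y(1) minus_equality by blast
  thus ?thesis using subringE(5)[OF subfieldE(1)[OF E] b(1)] by simp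
qed

lemma (in algebraically_closed) exists_root:
  assumes "p \<in> carrier (poly_ring L)" "degree p > 0"
  obtains y where "y \<in> carrier L" "eval p y = \<zero>\<^bsub>L\<^esub>"
proof -
  have "size (roots p) > 0"
    using roots_over_carrier[OF assms(1)] assms(2) unfolding splitted_def by simp
  then obtain y where "y \<in># roots p" by (metis multiset_nonemptyE nonempty_has_size)
  thus ?thesis
    using roots_mem_iff_is_root[OF assms(1)] that unfolding is_root_def by blast
qed

text \<open>An irreducible factor over \<open>E\<close> has some root in \<open>R\<close>, which
  lies in \<open>E\<close> by hypothesis; an irreducible polynomial with a root in its own field is
  linear.\<close>

lemma (in field) roots_in_subfield_imp_splitted:
  assumes ac: "algebraically_closed R" and E: "subfield E R" and p: "p \<in> carrier (E[X])" "p \<noteq> []"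
    and r: "\<And>y. \<lbrakk> y \<in> carrier R; eval p y = \<zero> \<rbrakk> \<Longrightarrow> y \<in> E"
  shows "ring.splitted (R \<lparr> carrier := E \<rparr>) p"
proof -
  interpret E: field "R \<lparr> carrier := E \<rparr>" using subfield_iff(2)[OF E] .
  note sub = subfieldE(1)[OF E]
  note cons = univ_poly_consistent[OF sub]
  show ?thesis
  proof (rule E.trivial_factors_imp_splitted)
    show "p \<in> carrier (poly_ring (R \<lparr> carrier := E \<rparr>))" using p by (simp add: cons)
  next
    fix q assume "q \<in> carrier (poly_ring (R \<lparr> carrier := E \<rparr>))"
      and "pirreducible\<^bsub>R \<lparr> carrier := E \<rparr>\<^esub> (carrier (R \<lparr> carrier := E \<rparr>)) q"
      and "q pdivides\<^bsub>R \<lparr> carrier := E \<rparr>\<^esub> p"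
    hence q: "q \<in> carrier (E[X])" "pirreducible E q" "q divides\<^bsub>E[X]\<^esub> p"
      by (simp_all add: cons pdivides_def)
    have qR: "q \<in> carrier (poly_ring R)" "q pdivides p"
      using carrier_polynomial_shell[OF sub q(1)] q(3) pdivides_iff_shell[OF E q(1) p(1)] by auto
    have "degree q > 0" using pirreducible_degree[OF E q(1,2)] by linarith
    then obtain y where y: "y \<in> carrier R" "eval q y = \<zero>"
      using algebraically_closed.exists_root[OF ac qR(1)] by blast
    have "y \<in> E"
      using r[OF y(1)] pdivides_imp_root_sharing[OF qR y(1)] y by auto
    hence "E.is_root q y"
      unfolding E.is_root_def using y pirreducibleE(1)[OF sub q(1,2)] sub by simp
    hence "E.roots q \<noteq> {#}"
      using E.roots_mem_iff_is_root[of q y] q(1) by (auto simp: cons)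
    thus "degree q \<le> 1"
      using E.pirreducible_roots[of q] q by (fastforce simp: cons)
  qed
qed

section \<open>Extending homomorphisms to automorphisms\<close>

text \<open>The automorphisms of \<open>R\<close> over \<open>A\<close>, as functions whose values
  outside the carrier are arbitrary.\<close>

definition (in ring) Gal :: "'a set \<Rightarrow> ('a \<Rightarrow> 'a) set"
  where "Gal A = { \<tau> \<in> ring_iso R R. \<forall>a \<in> A. \<tau> a = a }"

text \<open>
  The graph of a ring homomorphism that is the identity on \<open>A\<close> and is defined on a subring; graphs turn
  the extension order into inclusion, as needed for Zorn's lemma.
\<close>

definition (in ring) partial_hom :: "'a set \<Rightarrow> ('a \<times> 'a) set \<Rightarrow> bool"
  where "partial_hom A g \<longleftrightarrow>
    g \<subseteq> carrier R \<times> carrier R \<and> (\<forall>a \<in> A. (a, a) \<in> g) \<and> single_valued g \<and>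
    (\<forall>x y x' y'. (x, y) \<in> g \<and> (x', y') \<in> g \<longrightarrow>
       (x \<oplus> x', y \<oplus> y') \<in> g \<and> (x \<otimes> x', y \<otimes> y') \<in> g)"

lemma (in ring) partial_hom_Domain:
  assumes A: "subring A R" and g: "partial_hom A g"
  shows "subring (Domain g) R"
proof (rule subringI)
  show "Domain g \<subseteq> carrier R" using g unfolding partial_hom_def by blast
  show "\<one> \<in> Domain g" using g subringE(3)[OF A] unfolding partial_hom_def by blast
  show "h1 \<oplus> h2 \<in> Domain g" "h1 \<otimes> h2 \<in> Domain g" if "h1 \<in> Domain g" "h2 \<in> Domain g" for h1 h2
    using g that unfolding partial_hom_def by blast+
  show "\<ominus> h \<in> Domain g" if h: "h \<in> Domain g" for h
  proof -
    \<comment> \<open>Negation is not among the closure conditions of \<open>partial_hom\<close>; it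
      is recovered as multiplication by \<open>\<ominus> \<one>\<close>, which lies in
      \<open>A\<close>.\<close>
    have "(\<ominus> \<one>, \<ominus> \<one>) \<in> g"
      using g subringE(5)[OF A subringE(3)[OF A]] unfolding partial_hom_def by blast
    hence "(\<ominus> \<one>) \<otimes> h \<in> Domain g" using g h unfolding partial_hom_def by blast
    moreover have "h \<in> carrier R" using h g unfolding partial_hom_def by blast
    ultimately show ?thesis using l_minus[of \<one> h] by simp
  qed
qed

lemma (in ring) partial_hom_function:
  assumes A: "subring A R" and g: "partial_hom A g"
  obtains \<phi> where "ring_hom_ring (R \<lparr> carrier := Domain g \<rparr>) R \<phi>"
    and "g = { (x, \<phi> x) | x. x \<in> Domain g }" and "\<And>a. a \<in> A \<Longrightarrow> \<phi> a = a"
proof -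
  have sv: "single_valued g" using g unfolding partial_hom_def by blast
  define \<phi> where "\<phi> = (\<lambda>x. THE y. (x, y) \<in> g)"
  have eq: "\<phi> x = y" if "(x, y) \<in> g" for x y
    unfolding \<phi>_def using that sv by (auto intro!: the_equality dest: single_valuedD)
  have one: "(\<one>, \<one>) \<in> g" using g subringE(3)[OF A] unfolding partial_hom_def by blast
  have "\<phi> \<in> ring_hom (R \<lparr> carrier := Domain g \<rparr>) R"
  proof (rule ring_hom_memI)
    show "\<phi> x \<in> carrier R" if "x \<in> carrier (R \<lparr> carrier := Domain g \<rparr>)" for x
      using that g eq unfolding partial_hom_def by auto
    show "\<phi> (x \<otimes>\<^bsub>R \<lparr> carrier := Domain g \<rparr>\<^esub> y) = \<phi> x \<otimes> \<phi> y"
      "\<phi> (x \<oplus>\<^bsub>R \<lparr> carrier := Domain g \<rparr>\<^esub> y) = \<phi> x \<oplus> \<phi> y"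
      if xy: "x \<in> carrier (R \<lparr> carrier := Domain g \<rparr>)" "y \<in> carrier (R \<lparr> carrier := Domain g \<rparr>)" for x y
    proof -
      obtain u v where uv: "(x, u) \<in> g" "(y, v) \<in> g" using xy by auto
      hence "(x \<oplus> y, u \<oplus> v) \<in> g" "(x \<otimes> y, u \<otimes> v) \<in> g"
        using g unfolding partial_hom_def by blast+
      thus "\<phi> (x \<otimes>\<^bsub>R \<lparr> carrier := Domain g \<rparr>\<^esub> y) = \<phi> x \<otimes> \<phi> y"
        "\<phi> (x \<oplus>\<^bsub>R \<lparr> carrier := Domain g \<rparr>\<^esub> y) = \<phi> x \<oplus> \<phi> y"
        using uv eq by simp_all
    qed
    show "\<phi> \<one>\<^bsub>R \<lparr> carrier := Domain g \<rparr>\<^esub> = \<one>" using eq[OF one] by simp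
  qed
  hence "ring_hom_ring (R \<lparr> carrier := Domain g \<rparr>) R \<phi>"
    using ring_hom_ringI2 subring_is_ring[OF partial_hom_Domain[OF assms]] ring_axioms by blast
  moreover have "g = { (x, \<phi> x) | x. x \<in> Domain g }" using eq by auto
  moreover have "\<phi> a = a" if "a \<in> A" for a using eq that g unfolding partial_hom_def by blast
  ultimately show thesis using that by blast
qed

text \<open>The extension sends each value \<open>q(x)\<close> to the value at \<open>y\<close> of
  \<open>q\<close> with \<open>\<phi>\<close> applied to its coefficients; \<open>wd\<close> is
  exactly what makes this well defined.\<close>

lemma (in field) partial_hom_extend:
  assumes F: "subring F R" and hom: "ring_hom_ring (R \<lparr> carrier := F \<rparr>) R \<phi>"
    and A: "A \<subseteq> F" "\<And>a. a \<in> A \<Longrightarrow> \<phi> a = a"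
    and xy: "x \<in> carrier R" "y \<in> carrier R"
    and wd: "\<And>q. \<lbrakk> set q \<subseteq> F; eval q x = \<zero> \<rbrakk> \<Longrightarrow> eval (map \<phi> q) y = \<zero>"
  shows "\<exists>g. partial_hom A g \<and> { (z, \<phi> z) | z. z \<in> F } \<subseteq> g \<and> (x, y) \<in> g"
proof -
  interpret h: ring_hom_ring "R \<lparr> carrier := F \<rparr>" R \<phi> by (rule hom)
  \<comment> \<open>Here \<open>q\<close> is any coefficient list, leading zeros allowed, so
    \<open>[z]\<close> is admissible even for \<open>z = \<zero>\<close>.\<close>
  define g where "g = { (eval q x, eval (map \<phi> q) y) | q. set q \<subseteq> F }"
  have Fc: "F \<subseteq> carrier R" using subringE(1)[OF F] .
  have \<phi>c: "\<phi> z \<in> carrier R" if "z \<in> F" for z using h.hom_closed that by simp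
  have c: "set q \<subseteq> carrier R" "set (map \<phi> q) \<subseteq> carrier R" if "set q \<subseteq> F" for q
    using that Fc \<phi>c by auto
  have Fadd: "set (poly_add p q) \<subseteq> F" and Fmult: "set (poly_mult p q) \<subseteq> F"
    if "set p \<subseteq> F" "set q \<subseteq> F" for p q
    using polynomial_incl poly_add_is_polynomial[OF F that] poly_mult_is_polynomial[OF F that] by blast+
  have mapadd: "eval (map \<phi> (poly_add p q)) y = eval (map \<phi> p) y \<oplus> eval (map \<phi> q) y"
    if "set p \<subseteq> F" "set q \<subseteq> F" for p q
  proof -
    have "normalize (map \<phi> (poly_add p q)) = poly_add (map \<phi> p) (map \<phi> q)"
      using h.poly_add_hom'[of p q] that F by simp
    thus ?thesis
      using eval_normalize[OF c(2)[OF Fadd[OF that]] xy(2)] eval_poly_add[OF c(2) c(2) xy(2)] that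
      by metis
  qed
  have mapmult: "eval (map \<phi> (poly_mult p q)) y = eval (map \<phi> p) y \<otimes> eval (map \<phi> q) y"
    if "set p \<subseteq> F" "set q \<subseteq> F" for p q
  proof -
    have "normalize (map \<phi> (poly_mult p q)) = poly_mult (map \<phi> p) (map \<phi> q)"
      using h.poly_mult_hom'[of p q] that F by simp
    thus ?thesis
      using eval_normalize[OF c(2)[OF Fmult[OF that]] xy(2)] eval_poly_mult[OF c(2) c(2) xy(2)] that
      by metis
  qed
  have gc: "g \<subseteq> carrier R \<times> carrier R"
    unfolding g_def using eval_in_carrier[OF c(1) xy(1)] eval_in_carrier[OF c(2) xy(2)] by auto
  have const: "(z, \<phi> z) \<in> g" if "z \<in> F" for z
    unfolding g_def using that Fc \<phi>c xy by (auto intro!: exI[of _ "[z]"])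
  have one: "\<phi> \<one> = \<one>" using h.hom_one by simp
  have zero: "\<phi> \<zero> = \<zero>" using h.hom_zero by simp
  have var: "(x, y) \<in> g"
    unfolding g_def using subringE(2,3)[OF F] xy one zero by (auto intro!: exI[of _ "[\<one>, \<zero>]"])
  have closed: "(u \<oplus> u', v \<oplus> v') \<in> g" "(u \<otimes> u', v \<otimes> v') \<in> g" if g: "(u, v) \<in> g" "(u', v') \<in> g" for u v u' v'
  proof -
    obtain q q' where q: "set q \<subseteq> F" "set q' \<subseteq> F" "u = eval q x" "u' = eval q' x"
      "v = eval (map \<phi> q) y" "v' = eval (map \<phi> q') y"
      using g unfolding g_def by blast
    show "(u \<oplus> u', v \<oplus> v') \<in> g"
      unfolding g_def using q Fadd[OF q(1,2)] mapadd[OF q(1,2)] eval_poly_add[OF c(1) c(1) xy(1)]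
      by (auto intro!: exI[of _ "poly_add q q'"])
    show "(u \<otimes> u', v \<otimes> v') \<in> g"
      unfolding g_def using q Fmult[OF q(1,2)] mapmult[OF q(1,2)] eval_poly_mult[OF c(1) c(1) xy(1)]
      by (auto intro!: exI[of _ "poly_mult q q'"])
  qed
  have "single_valued g"
  proof (rule single_valuedI)
    fix u v v' assume g: "(u, v) \<in> g" "(u, v') \<in> g"
    have in_c: "u \<in> carrier R" "v \<in> carrier R" "v' \<in> carrier R" using g gc by auto
    \<comment> \<open>Multiplying one pair by \<open>\<ominus> \<one>\<close> and adding the other
      reduces uniqueness to the pair \<open>(\<zero>, v \<ominus> v')\<close>, where
      \<open>wd\<close> applies.\<close>
    have m1: "\<ominus> \<one> \<in> F" using subringE(3,5)[OF F] by blast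
    have "\<phi> (\<ominus> \<one>) = \<ominus> \<one>"
    proof -
      have "\<phi> (\<ominus> \<one>) \<oplus> \<phi> \<one> = \<phi> (\<ominus> \<one> \<oplus> \<one>)"
        using h.hom_add[of "\<ominus> \<one>" \<one>] m1 subringE(3)[OF F] by simp
      hence "\<phi> (\<ominus> \<one>) \<oplus> \<one> = \<zero>" using one zero by (simp add: l_neg)
      thus ?thesis using minus_equality \<phi>c[OF m1] by (metis a_comm one_closed minus_minus)
    qed
    hence "(\<ominus> \<one> \<otimes> u, \<ominus> \<one> \<otimes> v') \<in> g" using closed(2)[OF _ g(2)] const[OF m1] by metis
    hence "(u \<oplus> \<ominus> \<one> \<otimes> u, v \<oplus> \<ominus> \<one> \<otimes> v') \<in> g" using closed(1)[OF g(1)] by blast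
    hence "(\<zero>, v \<ominus> v') \<in> g" using in_c by (simp add: l_minus r_neg a_minus_def)
    then obtain q where "set q \<subseteq> F" "eval q x = \<zero>" "v \<ominus> v' = eval (map \<phi> q) y"
      unfolding g_def by auto
    hence "v \<ominus> v' = \<zero>" using wd by simp
    thus "v = v'" using in_c by simp
  qed
  hence "partial_hom A g"
    unfolding partial_hom_def using gc closed const A by (metis subsetD)
  thus ?thesis using const var by blast
qed

text \<open>This discharges \<open>wd\<close> in \<open>partial_hom_extend\<close>: \<open>q\<close>
  is a multiple of the minimal polynomial of \<open>x\<close>, and \<open>\<phi>\<close> preserves
  the factorization.\<close>

lemma (in field) eval_map_eq_zero_of_Irr:
  assumes F: "subfield F R" and hom: "ring_hom_ring (R \<lparr> carrier := F \<rparr>) R \<phi>"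
    and xy: "x \<in> carrier R" "(algebraic over F) x" "y \<in> carrier R" "eval (map \<phi> (Irr F x)) y = \<zero>"
    and q: "set q \<subseteq> F" "eval q x = \<zero>"
  shows "eval (map \<phi> q) y = \<zero>"
proof -
  interpret h: ring_hom_ring "R \<lparr> carrier := F \<rparr>" R \<phi> by (rule hom)
  note sub = subfieldE(1)[OF F]
  have Fc: "F \<subseteq> carrier R" using subfieldE(3)[OF F] .
  have c: "set (map \<phi> q) \<subseteq> carrier R" if "set q \<subseteq> F" for q
    using that h.hom_closed by auto
  have inF: "set p \<subseteq> F" if "p \<in> carrier (F[X])" for p
    using that polynomial_incl univ_poly_carrier by blast
  let ?n = "normalize q"
  have n: "?n \<in> carrier (F[X])" using normalize_gives_polynomial[OF q(1)] univ_poly_carrier by blast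
  have "eval ?n x = \<zero>" using q Fc eval_normalize[OF _ xy(1)] by auto
  hence "Irr F x divides\<^bsub>F[X]\<^esub> ?n"
    using Irr_minimal[OF F xy(1,2) n] pdivides_iff_shell[OF F IrrE(1)[OF F xy(1,2)] n] by blast
  then obtain r where r: "r \<in> carrier (F[X])" "?n = poly_mult (Irr F x) r"
    unfolding factor_def univ_poly_mult by blast
  note I = IrrE(1)[OF F xy(1,2)]
  have "normalize (map \<phi> ?n) = poly_mult (map \<phi> (Irr F x)) (map \<phi> r)"
    using h.poly_mult_hom'[of "Irr F x" r] inF[OF I] inF[OF r(1)] sub r(2) by simp
  hence "eval (map \<phi> ?n) y = eval (map \<phi> (Irr F x)) y \<otimes> eval (map \<phi> r) y"
    using eval_normalize[OF c[OF inF[OF n]] xy(3)]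
      eval_poly_mult[OF c[OF inF[OF I]] c[OF inF[OF r(1)]] xy(3)] by simp
  hence z: "eval (map \<phi> ?n) y = \<zero>"
    using xy(4) eval_in_carrier[OF c[OF inF[OF r(1)]] xy(3)] by simp
  \<comment> \<open>Back from the normalized polynomial to \<open>q\<close>: they differ by leading
    zeros, which \<open>\<phi>\<close> maps to zeros.\<close>
  obtain k where k: "q = replicate k \<zero> @ ?n" using normalize_trick by blast
  have "\<phi> \<zero> = \<zero>" using h.hom_zero by simp
  hence "map \<phi> q = replicate k \<zero> @ map \<phi> ?n" using k by (metis map_append map_replicate)
  thus ?thesis using eval_replicate[OF c[OF inF[OF n]] xy(3)] z by simp
qed

text \<open>This adds nothing to \<open>algebraic_closure\<close>; it names the ambient field
  \<open>R\<close> and leaves \<open>L\<close> free for the subextension.\<close>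

locale algebraic_closure_over = algebraic_closure R K for R (structure) and K

context algebraic_closure_over
begin

lemma algebraic_over:
  assumes "K \<subseteq> A" "x \<in> carrier R" shows "(algebraic over A) x"
  using algebraic_mono[OF assms(1) algebraic_extension[OF assms(2)]] .

lemma subring_imp_subfield:
  assumes "subring S R" "K \<subseteq> S" shows "subfield S R"
  using subring_algebraic_imp_subfield[OF subfield_axioms assms] algebraic_extension
    subringE(1)[OF assms(1)] by blast

text \<open>An endomorphism over \<open>K\<close> is injective and maps the finite root set of each
  minimal polynomial over \<open>K\<close> into itself, hence permutes it; so every \<open>w\<close>
  is attained.\<close>

lemma endomorphism_surj:
  assumes hom: "ring_hom_ring R R \<phi>" and fix_K: "\<And>a. a \<in> K \<Longrightarrow> \<phi> a = a"
  shows "\<phi> \<in> ring_iso R R"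
proof -
  interpret \<phi>: ring_hom_ring R R \<phi> by (rule hom)
  have inj: "inj_on \<phi> (carrier R)"
    using \<phi>.img_is_subfield(1)[OF carrier_is_subfield] by simp
  have "w \<in> \<phi> ` carrier R" if w: "w \<in> carrier R" for w
  proof -
    note Irr = IrrE[OF subfield_axioms w algebraic_extension[OF w]]
    note pR = carrier_polynomial_shell[OF subfieldE(1)[OF subfield_axioms] Irr(1)]
    let ?p = "Irr K w" and ?Z = "{ v. is_root (Irr K w) v }"
    have setp: "set ?p \<subseteq> K" using Irr(1) polynomial_incl univ_poly_carrier by blast
    hence map: "map \<phi> ?p = ?p" using fix_K by (auto intro: map_idI)
    have "\<phi> v \<in> ?Z" if "v \<in> ?Z" for v
      using that \<phi>.eval_hom'[of v ?p] map setp subfieldE(3)[OF subfield_axioms] unfolding is_root_def by auto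
    moreover have "inj_on \<phi> ?Z" using inj unfolding is_root_def inj_on_def by blast
    ultimately have "\<phi> ` ?Z = ?Z"
      using endo_inj_surj[OF finite_number_of_roots[OF pR]] by blast
    moreover have "w \<in> ?Z"
      using w Irr pirreducibleE(1)[OF subfieldE(1)[OF subfield_axioms] Irr(1,2)] unfolding is_root_def by simp
    ultimately show ?thesis unfolding is_root_def by blast
  qed
  hence "bij_betw \<phi> (carrier R) (carrier R)"
    using inj \<phi>.hom_closed unfolding bij_betw_def by blast
  thus ?thesis using \<phi>.homh unfolding ring_iso_def by blast
qed

text \<open>Zorn's lemma gives a maximal graph above \<open>g0\<close>. Its domain is a field, being
  algebraic over \<open>K\<close>, and any further \<open>z\<close> could be adjoined by sending it
  to a root of its transported minimal polynomial. So the domain is all of \<open>R\<close>, and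
  \<open>endomorphism_surj\<close> yields an automorphism.\<close>

lemma partial_hom_extends_to_iso:
  assumes A: "subfield A R" "K \<subseteq> A" and g0: "partial_hom A g0"
  obtains \<tau> where "\<tau> \<in> Gal A" "\<And>x y. (x, y) \<in> g0 \<Longrightarrow> \<tau> x = y"
proof -
  note subA = subfieldE(1)[OF A(1)]
  define P where "P = { g. partial_hom A g \<and> g0 \<subseteq> g }"
  have "\<exists>M \<in> P. \<forall>g \<in> P. M \<subseteq> g \<longrightarrow> g = M"
  proof (rule subset_Zorn_nonempty)
    show "P \<noteq> {}" unfolding P_def using g0 by blast
    fix C assume C: "C \<noteq> {}" "subset.chain P C"
    hence PC: "\<And>g. g \<in> C \<Longrightarrow> partial_hom A g \<and> g0 \<subseteq> g"
      unfolding P_def subset.chain_def by blast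
    \<comment> \<open>Single-valuedness and closure each concern two pairs at a time, and in a chain
      any two pairs lie in a common member.\<close>
    have common: "\<exists>g \<in> C. u \<in> g \<and> v \<in> g" if uv: "u \<in> \<Union>C" "v \<in> \<Union>C" for u v
    proof -
      obtain g h where gh: "g \<in> C" "h \<in> C" "u \<in> g" "v \<in> h" using uv by blast
      hence "g \<subseteq> h \<or> h \<subseteq> g" using C(2) unfolding subset.chain_def by blast
      thus ?thesis using gh by blast
    qed
    have "single_valued (\<Union>C)"
    proof (rule single_valuedI)
      fix x y z assume "(x, y) \<in> \<Union>C" "(x, z) \<in> \<Union>C"
      then obtain g where "g \<in> C" "(x, y) \<in> g" "(x, z) \<in> g" using common by blast
      thus "y = z" using PC unfolding partial_hom_def by (meson single_valuedD)
    qed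
    moreover have "(x \<oplus> x', y \<oplus> y') \<in> \<Union>C \<and> (x \<otimes> x', y \<otimes> y') \<in> \<Union>C"
      if xy: "(x, y) \<in> \<Union>C" "(x', y') \<in> \<Union>C" for x y x' y'
    proof -
      obtain g where "g \<in> C" "(x, y) \<in> g" "(x', y') \<in> g" using common[OF xy] by blast
      thus ?thesis using PC unfolding partial_hom_def by blast
    qed
    moreover have "\<Union>C \<subseteq> carrier R \<times> carrier R"
      using PC unfolding partial_hom_def by blast
    moreover have "\<forall>a \<in> A. (a, a) \<in> \<Union>C"
      using PC C(1) unfolding partial_hom_def by blast
    ultimately have "partial_hom A (\<Union>C)" unfolding partial_hom_def by blast
    thus "\<Union>C \<in> P" unfolding P_def using C(1) PC by blast
  qed
  then obtain M where MP: "M \<in> P" "\<And>g. \<lbrakk> g \<in> P; M \<subseteq> g \<rbrakk> \<Longrightarrow> g = M" by auto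
  have M: "partial_hom A M" "g0 \<subseteq> M" using MP(1) unfolding P_def by auto
  have max: "g = M" if "partial_hom A g" "M \<subseteq> g" for g
    using MP(2)[of g] M(2) that unfolding P_def by auto
  let ?D = "Domain M"
  note subD = partial_hom_Domain[OF subA M(1)]
  have AD: "A \<subseteq> ?D" using M(1) unfolding partial_hom_def by blast
  have D: "subfield ?D R" using subring_imp_subfield[OF subD] AD A(2) by blast
  obtain \<phi> where \<phi>: "ring_hom_ring (R \<lparr> carrier := ?D \<rparr>) R \<phi>"
    "M = { (x, \<phi> x) | x. x \<in> ?D }" "\<And>a. a \<in> A \<Longrightarrow> \<phi> a = a"
    using partial_hom_function[OF subA M(1)] by blast
  interpret \<phi>: ring_hom_ring "R \<lparr> carrier := ?D \<rparr>" R \<phi> by (rule \<phi>(1))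
  have "z \<in> ?D" if z: "z \<in> carrier R" for z
  proof -
    have algz: "(algebraic over ?D) z" using algebraic_over[OF _ z] A(2) AD by blast
    note Irr = IrrE[OF D z algz]
    let ?p = "Irr ?D z"
    have p: "?p \<noteq> []" "set ?p \<subseteq> ?D" "degree ?p > 0"
      using pirreducibleE(1)[OF subD Irr(1,2)] pirreducible_degree[OF D Irr(1,2)]
        Irr(1) polynomial_incl univ_poly_carrier by (blast, blast, linarith)
    have "\<phi> \<one> = \<one>" using \<phi>.hom_one by simp
    \<comment> \<open>Since \<open>?p\<close> is monic, its image is again a genuine polynomial of
      the same positive degree, so it has a root in \<open>R\<close>.\<close>
    hence "lead_coeff (map \<phi> ?p) = \<one>" using Irr(3) p(1) by (simp add: hd_map)
    moreover have "\<phi> a \<in> carrier R" if "a \<in> ?D" for a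
      using \<phi>.hom_closed[of a] that by simp
    hence "\<phi> ` ?D \<subseteq> carrier R" by blast
    hence "set (map \<phi> ?p) \<subseteq> carrier R" using image_mono[OF p(2), of \<phi>] unfolding set_map by order
    ultimately have "map \<phi> ?p \<in> carrier (poly_ring R)"
      using univ_poly_carrier[of R "carrier R" "map \<phi> ?p"] unfolding polynomial_def by auto
    then obtain w where w: "w \<in> carrier R" "eval (map \<phi> ?p) w = \<zero>"
      using exists_root[of "map \<phi> ?p"] p(3) by auto
    have "\<exists>g. partial_hom A g \<and> { (v, \<phi> v) | v. v \<in> ?D } \<subseteq> g \<and> (z, w) \<in> g"
      by (rule partial_hom_extend[OF subD \<phi>(1) AD \<phi>(3) z w(1)])
        (use eval_map_eq_zero_of_Irr[OF D \<phi>(1) z algz w] in blast)+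
    hence "\<exists>g. partial_hom A g \<and> M \<subseteq> g \<and> (z, w) \<in> g" unfolding \<phi>(2)[symmetric] .
    then obtain g where g: "partial_hom A g" "M \<subseteq> g" "(z, w) \<in> g" by blast
    thus ?thesis using max by blast
  qed
  hence D_eq: "?D = carrier R" using subringE(1)[OF subD] by blast
  hence "ring_hom_ring R R \<phi>" using \<phi>(1) by simp
  hence "\<phi> \<in> Gal A" unfolding Gal_def using endomorphism_surj \<phi>(3) A(2) by blast
  moreover have "\<phi> x = y" if "(x, y) \<in> g0" for x y
  proof -
    have "(x, y) \<in> { (x, \<phi> x) | x. x \<in> ?D }" using that M(2) unfolding \<phi>(2)[symmetric] by blast
    thus ?thesis by blast
  qed
  ultimately show thesis using that by blast
qed

text \<open>Up to a scalar \<open>p\<close> is the minimal polynomial of \<open>x\<close>, so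
  \<open>x\<close> may be sent to \<open>y\<close> on \<open>A[x]\<close>; this partial homomorphism
  then extends to \<open>R\<close>.\<close>

lemma Gal_transitive:
  assumes A: "subfield A R" "K \<subseteq> A" and p: "p \<in> carrier (A[X])" "pirreducible A p"
    and x: "x \<in> carrier R" "eval p x = \<zero>" and y: "y \<in> carrier R" "eval p y = \<zero>"
  obtains \<tau> where "\<tau> \<in> Gal A" "\<tau> x = y"
proof -
  note subA = subfieldE(1)[OF A(1)]
  note alg = algebraic_over[OF A(2) x(1)]
  note Irr = IrrE[OF A(1) x(1) alg]
  have "Irr A x divides\<^bsub>A[X]\<^esub> p"
    using Irr_minimal[OF A(1) x(1) alg p(1) x(2)] pdivides_iff_shell[OF A(1) Irr(1) p(1)] by blast
  hence "Irr A x \<sim>\<^bsub>A[X]\<^esub> p"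
    using divides_pirreducible_condition[OF p(2) Irr(1)] pirreducibleE(2)[OF subA Irr(1,2)] by blast
  then obtain k where k: "k \<in> A" "Irr A x = [k] \<otimes>\<^bsub>A[X]\<^esub> p"
    using associated_polynomials_iff[OF A(1) Irr(1) p(1)] by blast
  have "set [k] \<subseteq> carrier R" "set p \<subseteq> carrier R"
    using k(1) p(1) subfieldE(3)[OF A(1)] polynomial_incl univ_poly_carrier by (auto, blast)
  hence "eval (Irr A x) y = \<zero>"
    using eval_poly_mult[OF _ _ y(1), of "[k]" p] y k(2) by (simp add: univ_poly_mult)
  moreover have hom: "ring_hom_ring (R \<lparr> carrier := A \<rparr>) R id"
    using subringE(1)[OF subA] by (intro ring_hom_ringI2 subring_is_ring[OF subA] ring_axioms ring_hom_memI) auto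
  ultimately obtain g where "partial_hom A g" "(x, y) \<in> g"
    using partial_hom_extend[OF subA hom subset_refl _ x(1) y(1)]
      eval_map_eq_zero_of_Irr[OF A(1) hom x(1) alg y(1)]
    by auto
  thus thesis using partial_hom_extends_to_iso[OF A] that by metis
qed

end

section \<open>Normality as stability under automorphisms\<close>

text \<open>\<open>A \<subseteq> E\<close> is left out on purpose: below, stability is also used
  over base fields that are not contained in \<open>E\<close>.\<close>

definition (in ring) stable :: "'a set \<Rightarrow> 'a set \<Rightarrow> bool"
  where "stable A E \<longleftrightarrow> (\<forall>\<tau> \<in> Gal A. \<tau> ` E \<subseteq> E)"

lemma poly_carrier_mono:
  assumes "A \<subseteq> E" "p \<in> carrier (A[X]\<^bsub>R\<^esub>)" shows "p \<in> carrier (E[X]\<^bsub>R\<^esub>)"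
  using assms univ_poly_carrier[of R A p] univ_poly_carrier[of R E p] unfolding polynomial_def by auto

context field
begin

lemma Gal_hom:
  assumes "\<tau> \<in> Gal A" shows "ring_hom_ring R R \<tau>"
  using assms ring_hom_ringI2 ring_axioms unfolding Gal_def ring_iso_def by blast

lemma Gal_closed: "\<lbrakk> \<tau> \<in> Gal A; x \<in> carrier R \<rbrakk> \<Longrightarrow> \<tau> x \<in> carrier R"
  unfolding Gal_def using ring_iso_memE(1) by fast

lemma Gal_inj: "\<tau> \<in> Gal A \<Longrightarrow> inj_on \<tau> (carrier R)"
  unfolding Gal_def ring_iso_def bij_betw_def by blast

lemma Gal_fixes: "\<lbrakk> \<tau> \<in> Gal A; a \<in> A \<rbrakk> \<Longrightarrow> \<tau> a = a"
  unfolding Gal_def by blast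

lemma Gal_antimono: "A \<subseteq> B \<Longrightarrow> Gal B \<subseteq> Gal A"
  unfolding Gal_def by blast

lemma Gal_comp: "\<lbrakk> \<tau> \<in> Gal A; \<rho> \<in> Gal A \<rbrakk> \<Longrightarrow> \<rho> \<circ> \<tau> \<in> Gal A"
  unfolding Gal_def using ring_iso_set_trans by fastforce

lemma stableD: "\<lbrakk> stable A E; \<tau> \<in> Gal A; x \<in> E \<rbrakk> \<Longrightarrow> \<tau> x \<in> E"
  unfolding stable_def by blast

lemma stable_mono: "\<lbrakk> stable A E; A \<subseteq> B \<rbrakk> \<Longrightarrow> stable B E"
  unfolding stable_def using Gal_antimono by blast

lemma stable_self: "stable A A"
  unfolding stable_def by (auto simp: Gal_fixes)

lemma Gal_root:
  assumes "\<tau> \<in> Gal A" "set p \<subseteq> A" "A \<subseteq> carrier R" "x \<in> carrier R" "eval p x = \<zero>"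
  shows "eval p (\<tau> x) = \<zero>"
proof -
  interpret \<tau>: ring_hom_ring R R \<tau> by (rule Gal_hom[OF assms(1)])
  have "map \<tau> p = p" using Gal_fixes[OF assms(1)] assms(2) by (auto intro: map_idI)
  thus ?thesis using \<tau>.eval_hom'[of x p] assms by auto
qed

section \<open>Powers of monic linear polynomials\<close>

lemma eval_nat_pow:
  assumes "p \<in> carrier (poly_ring R)" "v \<in> carrier R"
  shows "eval (p [^]\<^bsub>poly_ring R\<^esub> (k :: nat)) v = (eval p v) [^] k"
proof -
  interpret ev: ring_hom_ring "poly_ring R" R "\<lambda>p. eval p v"
    by (rule eval_ring_hom[OF carrier_is_subring assms(2)])
  show ?thesis
    by (induction k) (simp_all add: assms(1))
qed

text \<open>All powers are formed in the single ring \<open>poly_ring R\<close>, so that powers with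
  coefficients in different subfields can be compared.\<close>

lemma subring_poly_pow_closed:
  assumes "subring A R" "p \<in> carrier (A[X])"
  shows "p [^]\<^bsub>poly_ring R\<^esub> (k :: nat) \<in> carrier (A[X])"
proof -
  interpret A: cring "A[X]" by (rule univ_poly_is_cring[OF assms(1)])
  have "p [^]\<^bsub>poly_ring R\<^esub> k = p [^]\<^bsub>A[X]\<^esub> k"
    by (induction k) (simp_all add: univ_poly_mult univ_poly_one nat_pow_def)
  thus ?thesis using assms(2) by simp
qed

lemma monic_linear_closed:
  "y \<in> carrier R \<Longrightarrow> [\<one>, \<ominus> y] \<in> carrier (poly_ring R)"
  using univ_poly_carrier[of R "carrier R" "[\<one>, \<ominus> y]"] unfolding polynomial_def by simp

lemma monic_linear_pow:
  assumes "z \<in> carrier R"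
  shows "[\<one>, \<ominus> z] [^]\<^bsub>poly_ring R\<^esub> (k :: nat) \<noteq> [] \<and> lead_coeff ([\<one>, \<ominus> z] [^]\<^bsub>poly_ring R\<^esub> k) = \<one>"
proof (induction k)
  case 0 thus ?case by (simp add: univ_poly_one nat_pow_def)
next
  case (Suc k)
  interpret UP: cring "poly_ring R" by (rule univ_poly_is_cring[OF carrier_is_subring])
  let ?q = "[\<one>, \<ominus> z]"
  have q: "?q \<in> carrier (poly_ring R)" using monic_linear_closed[OF assms] .
  note nz = polynomial_pow_not_zero[OF q]
  have "?q [^]\<^bsub>poly_ring R\<^esub> Suc k = poly_mult (?q [^]\<^bsub>poly_ring R\<^esub> k) ?q"
    by (simp add: univ_poly_mult)
  moreover have "polynomial (carrier R) (?q [^]\<^bsub>poly_ring R\<^esub> k)" "polynomial (carrier R) ?q"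
    using q UP.nat_pow_closed univ_poly_carrier by blast+
  ultimately show ?case
    using poly_mult_lead_coeff[OF carrier_is_subring, of "?q [^]\<^bsub>poly_ring R\<^esub> k" ?q]
      nz[of k] nz[of "Suc k"] Suc by simp
qed

lemma eval_monic_linear:
  "\<lbrakk> y \<in> carrier R; v \<in> carrier R \<rbrakk> \<Longrightarrow> eval [\<one>, \<ominus> y] v = v \<ominus> y"
  by (simp add: a_minus_def)

end

context algebraic_closure_over
begin

text \<open>An automorphism over \<open>A\<close> sends \<open>x\<close> to a root of its minimal
  polynomial, and these lie in \<open>E\<close> if \<open>E\<close> is normal. Conversely,
  \<open>Gal_transitive\<close> carries one root in \<open>E\<close> to every other root.\<close>

lemma normal_ext_iff_stable:
  assumes A: "subfield A R" "K \<subseteq> A"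
  shows "normal_ext A E \<longleftrightarrow> subfield E R \<and> A \<subseteq> E \<and> stable A E"
proof
  assume n: "normal_ext A E"
  hence E: "subfield E R" "A \<subseteq> E" unfolding normal_ext_def by auto
  note subA = subfieldE(1)[OF A(1)]
  have "\<tau> x \<in> E" if \<tau>: "\<tau> \<in> Gal A" and x: "x \<in> E" for \<tau> x
  proof -
    have xc: "x \<in> carrier R" using x subfieldE(3)[OF E(1)] by blast
    note Irr = IrrE[OF A(1) xc algebraic_over[OF A(2) xc]]
    have "ring.splitted (R \<lparr> carrier := E \<rparr>) (Irr A x)"
      using n Irr x unfolding normal_ext_def by blast
    moreover have setp: "set (Irr A x) \<subseteq> A" using Irr(1) polynomial_incl univ_poly_carrier by blast
    moreover have "Irr A x \<in> carrier (E[X])"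
      using poly_carrier_mono[OF E(2) Irr(1)] .
    ultimately show ?thesis
      using splitted_in_subfield_imp_roots_in[OF E(1) _ pirreducibleE(1)[OF subA Irr(1,2)] _ Gal_closed[OF \<tau> xc]]
        Gal_root[OF \<tau> setp subfieldE(3)[OF A(1)] xc Irr(4)] by blast
  qed
  thus "subfield E R \<and> A \<subseteq> E \<and> stable A E" using E unfolding stable_def by blast
next
  assume E: "subfield E R \<and> A \<subseteq> E \<and> stable A E"
  note subA = subfieldE(1)[OF A(1)]
  have Ec: "E \<subseteq> carrier R" using subfieldE(3) E by blast
  have "ring.splitted (R \<lparr> carrier := E \<rparr>) p"
    if p: "p \<in> carrier (A[X])" "pirreducible A p" and x: "x \<in> E" "eval p x = \<zero>" for p x
  proof (rule roots_in_subfield_imp_splitted[OF algebraically_closed_axioms])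
    show "subfield E R" using E by blast
    show "p \<in> carrier (E[X])"
      using poly_carrier_mono p(1) E by blast
    show "p \<noteq> []" using pirreducibleE(1)[OF subA p] .
    show "y \<in> E" if y: "y \<in> carrier R" "eval p y = \<zero>" for y
    proof -
      have "x \<in> carrier R" using x(1) Ec by blast
      from Gal_transitive[OF A p this x(2) y] obtain \<tau> where "\<tau> \<in> Gal A" "\<tau> x = y" .
      thus ?thesis using E x(1) stableD by blast
    qed
  qed
  thus "normal_ext A E"
    unfolding normal_ext_def using A E algebraic_over Ec by blast
qed

text \<open>Every conjugate of \<open>z\<close> over \<open>A\<close> is an image of
  \<open>z\<close> under \<open>Gal A\<close>, so \<open>z\<close> is the only root of its minimal
  polynomial, which must be \<open>(X - z)^n\<close>. In the inseparable case \<open>n > 1\<close>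
  is possible; membership of \<open>z\<close> in \<open>A\<close> cannot be expected.\<close>

lemma fixed_imp_power_over:
  assumes A: "subfield A R" "K \<subseteq> A" and z: "z \<in> carrier R" "\<forall>\<tau> \<in> Gal A. \<tau> z = z"
  shows "\<exists>n :: nat. n > 0 \<and> [\<one>, \<ominus> z] [^]\<^bsub>poly_ring R\<^esub> n \<in> carrier (A[X])"
proof -
  interpret UP: cring "poly_ring R" by (rule univ_poly_is_cring[OF carrier_is_subring])
  note subA = subfieldE(1)[OF A(1)]
  note Irr = IrrE[OF A(1) z(1) algebraic_over[OF A(2) z(1)]]
  let ?p = "Irr A z" and ?q = "[\<one>, \<ominus> z] :: 'a list"
  let ?n = "degree ?p"
  have p: "?p \<in> carrier (poly_ring R)" "?p \<noteq> []"
    using carrier_polynomial_shell[OF subA Irr(1)] pirreducibleE(1)[OF subA Irr(1,2)] by auto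
  have q: "?q \<in> carrier (poly_ring R)" using monic_linear_closed[OF z(1)] .
  have "y = z" if "y \<in># roots ?p" for y
  proof -
    have y: "y \<in> carrier R" "eval ?p y = \<zero>"
      using that roots_mem_iff_is_root[OF p(1)] unfolding is_root_def by auto
    then obtain \<tau> where "\<tau> \<in> Gal A" "\<tau> z = y" using Gal_transitive[OF A Irr(1,2) z(1) Irr(4)] by blast
    thus ?thesis using z(2) by auto
  qed
  hence "set_mset (roots ?p) \<subseteq> {z}" by blast
  hence "roots ?p = replicate_mset (size (roots ?p)) z"
    by (rule set_mset_subset_singletonD)
  hence "count (roots ?p) z = count (replicate_mset (size (roots ?p)) z) z"
    by (rule arg_cong)
  hence "count (roots ?p) z = size (roots ?p)" unfolding count_replicate_mset by simp
  \<comment> \<open>Over \<open>R\<close> the polynomial splits, so the number of roots with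
    multiplicity is the degree, and all of them are \<open>z\<close>.\<close>
  hence "alg_mult ?p z = ?n"
    using roots_over_carrier[OF p(1)] alg_mult_eq_count_roots[OF p(1)] unfolding splitted_def by simp
  hence "(?q [^]\<^bsub>poly_ring R\<^esub> ?n) pdivides ?p"
    using le_alg_mult_imp_pdivides[OF z(1) p(1)] by simp
  then obtain r where r: "r \<in> carrier (poly_ring R)" "?p = poly_mult (?q [^]\<^bsub>poly_ring R\<^esub> ?n) r"
    unfolding pdivides_def factor_def univ_poly_mult by blast
  have pol: "polynomial (carrier R) (?q [^]\<^bsub>poly_ring R\<^esub> ?n)" "polynomial (carrier R) r"
    using UP.nat_pow_closed[OF q] r(1) univ_poly_carrier by blast+
  have r0: "r \<noteq> []" using p(2) r(2) poly_mult_zero(2)[OF polynomial_incl[OF pol(1)]] by metis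
  \<comment> \<open>The cofactor \<open>r\<close> is constant by degrees, and equal to one since
    both sides are monic.\<close>
  have "?n = ?n + degree r"
    using poly_mult_degree_eq[OF carrier_is_subring pol] r0 polynomial_pow_not_zero[OF q, of ?n]
      polynomial_pow_degree[OF q, of ?n] r(2) by simp
  hence "degree r = 0" by linarith
  then obtain c where c: "r = [c]" using r0 by (cases r) auto
  have cc: "c \<in> carrier R" using polynomial_incl[OF pol(2)] c by simp
  have "\<one> = \<one> \<otimes> c"
    using poly_mult_lead_coeff[OF carrier_is_subring pol _ r0] monic_linear_pow[OF z(1), of ?n] Irr(3) r(2) c
    by simp
  hence "r = \<one>\<^bsub>poly_ring R\<^esub>" using c cc by (simp add: univ_poly_one)
  hence "?p = ?q [^]\<^bsub>poly_ring R\<^esub> ?n"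
    using r(2) UP.r_one[OF UP.nat_pow_closed[OF q, of ?n]] by (simp add: univ_poly_mult)
  moreover have "?n > 0" using pirreducible_degree[OF A(1) Irr(1,2)] by linarith
  ultimately show ?thesis using Irr(1) by metis
qed

text \<open>The power of \<open>X - z\<close> with exponent \<open>n * m\<close> has coefficients in
  both \<open>A\<close> and \<open>B\<close>; an automorphism over \<open>A \<inter> B\<close> maps
  its only root \<open>z\<close> to a root, hence to \<open>z\<close>.\<close>

lemma fixed_by_Gal_Int:
  assumes A: "subfield A R" "K \<subseteq> A" and B: "subfield B R" "K \<subseteq> B" and z: "z \<in> carrier R"
    and fA: "\<forall>\<tau> \<in> Gal A. \<tau> z = z" and fB: "\<forall>\<tau> \<in> Gal B. \<tau> z = z"
    and \<tau>: "\<tau> \<in> Gal (A \<inter> B)"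
  shows "\<tau> z = z"
proof -
  interpret UP: cring "poly_ring R" by (rule univ_poly_is_cring[OF carrier_is_subring])
  let ?q = "[\<one>, \<ominus> z] :: 'a list"
  have q: "?q \<in> carrier (poly_ring R)" using monic_linear_closed[OF z] .
  obtain n :: nat where n: "n > 0" "?q [^]\<^bsub>poly_ring R\<^esub> n \<in> carrier (A[X])"
    using fixed_imp_power_over[OF A z fA] by blast
  obtain m :: nat where m: "m > 0" "?q [^]\<^bsub>poly_ring R\<^esub> m \<in> carrier (B[X])"
    using fixed_imp_power_over[OF B z fB] by blast
  define w where "w = ?q [^]\<^bsub>poly_ring R\<^esub> (n * m)"
  have "w \<in> carrier (A[X])"
    using subring_poly_pow_closed[OF subfieldE(1)[OF A(1)] n(2), of m] UP.nat_pow_pow[OF q] w_def by simp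
  moreover have "w \<in> carrier (B[X])"
    using subring_poly_pow_closed[OF subfieldE(1)[OF B(1)] m(2), of n] UP.nat_pow_pow[OF q] w_def
    by (simp add: mult.commute)
  ultimately have w: "set w \<subseteq> A \<inter> B" using polynomial_incl univ_poly_carrier by blast
  have ev: "eval w v = (v \<ominus> z) [^] (n * m)" if "v \<in> carrier R" for v
    unfolding w_def using eval_nat_pow[OF q that] eval_monic_linear[OF z that] by simp
  have "z \<ominus> z = \<zero>" using z by (simp add: a_minus_def r_neg)
  hence "eval w z = \<zero>" using ev[OF z] n(1) m(1) nat_pow_zero[of "n * m"] by simp
  hence "(\<tau> z \<ominus> z) [^] (n * m) = \<zero>"
    using Gal_root[OF \<tau> w _ z] subfieldE(3)[OF A(1)] ev[OF Gal_closed[OF \<tau> z]] by auto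
  moreover have "u [^] (k :: nat) = \<zero> \<Longrightarrow> u = \<zero>" if "u \<in> carrier R" for u k
    using that by (induction k) (auto simp: integral_iff)
  ultimately have "\<tau> z \<ominus> z = \<zero>" using Gal_closed[OF \<tau> z] z by auto
  thus ?thesis using Gal_closed[OF \<tau> z] z by simp
qed

end

section \<open>Intersecting the base fields\<close>

context field
begin

text \<open>The monic polynomial with simple roots exactly at \<open>S\<close>, for finite
  \<open>S\<close>; on infinite sets \<open>finprod\<close> returns one.\<close>

definition linear_prod :: "'a set \<Rightarrow> 'a list"
  where "linear_prod S = (\<Otimes>\<^bsub>poly_ring R\<^esub> y \<in> S. [\<one>, \<ominus> y])"

lemma linear_prod_closed:
  assumes "S \<subseteq> carrier R" shows "linear_prod S \<in> carrier (poly_ring R)"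
proof -
  interpret UP: cring "poly_ring R" by (rule univ_poly_is_cring[OF carrier_is_subring])
  show ?thesis unfolding linear_prod_def using assms monic_linear_closed by (intro UP.finprod_closed) blast
qed

lemma linear_prod_insert:
  assumes "finite S" "insert y S \<subseteq> carrier R" "y \<notin> S"
  shows "linear_prod (insert y S) = poly_mult [\<one>, \<ominus> y] (linear_prod S)"
proof -
  interpret UP: cring "poly_ring R" by (rule univ_poly_is_cring[OF carrier_is_subring])
  have "linear_prod (insert y S) = [\<one>, \<ominus> y] \<otimes>\<^bsub>poly_ring R\<^esub> linear_prod S"
    unfolding linear_prod_def using assms monic_linear_closed by (intro UP.finprod_insert) blast+
  thus ?thesis by (simp add: univ_poly_mult)
qed

lemma linear_prod_empty: "linear_prod {} = [\<one>]"
proof -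
  interpret UP: cring "poly_ring R" by (rule univ_poly_is_cring[OF carrier_is_subring])
  show ?thesis unfolding linear_prod_def by (simp add: univ_poly_one)
qed

lemma set_linear_prod: "S \<subseteq> carrier R \<Longrightarrow> set (linear_prod S) \<subseteq> carrier R"
  using linear_prod_closed polynomial_incl univ_poly_carrier by blast

lemma eval_linear_prod:
  assumes "finite S" "S \<subseteq> carrier R" "v \<in> carrier R"
  shows "eval (linear_prod S) v = \<zero> \<longleftrightarrow> v \<in> S"
  using assms(1,2)
proof (induction S rule: finite_induct)
  case empty thus ?case using assms(3) by (simp add: linear_prod_empty)
next
  case (insert y S)
  have "eval (linear_prod (insert y S)) v = eval [\<one>, \<ominus> y] v \<otimes> eval (linear_prod S) v"
    unfolding linear_prod_insert[OF insert(1,4,2)]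
    by (rule eval_poly_mult[OF _ _ assms(3)]) (use insert(4) set_linear_prod in auto)
  hence "eval (linear_prod (insert y S)) v = (v \<ominus> y) \<otimes> eval (linear_prod S) v"
    using eval_monic_linear insert(4) assms(3) by simp
  moreover have "v \<ominus> y \<in> carrier R" "eval (linear_prod S) v \<in> carrier R" "v \<ominus> y = \<zero> \<longleftrightarrow> v = y"
    using insert(4) assms(3) eval_in_carrier[OF set_linear_prod assms(3)] by auto
  ultimately show ?case using insert integral_iff by auto
qed

text \<open>Injectivity is used twice: distinct factors stay distinct, and the leading coefficient
  stays nonzero, so that \<open>normalize\<close> changes nothing.\<close>

lemma map_linear_prod:
  assumes hom: "ring_hom_ring R R f" and inj: "inj_on f (carrier R)"
    and S: "finite S" "S \<subseteq> carrier R"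
  shows "map f (linear_prod S) = linear_prod (f ` S)"
  using S
proof (induction S rule: finite_induct)
  interpret f: ring_hom_ring R R f by (rule hom)
  case empty thus ?case by (simp add: linear_prod_empty)
next
  interpret f: ring_hom_ring R R f by (rule hom)
  case (insert y S)
  let ?q = "[\<one>, \<ominus> y]"
  have y: "y \<in> carrier R" "S \<subseteq> carrier R" using insert(4) by auto
  have fS: "insert (f y) (f ` S) \<subseteq> carrier R" using insert(4) by auto
  have notin: "f y \<notin> f ` S"
    using insert(2) y inj unfolding inj_on_def by blast
  note lin = linear_prod_insert[OF insert(1,4,2)]
  have "polynomial (carrier R) (linear_prod (insert y S))"
    using linear_prod_closed[OF insert(4)] univ_poly_carrier by blast
  moreover have "f a \<noteq> \<zero>" if "a \<in> carrier R" "a \<noteq> \<zero>" for a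
    using inj that f.hom_zero unfolding inj_on_def by (metis zero_closed)
  moreover have "set (map f (linear_prod (insert y S))) \<subseteq> carrier R"
    using set_linear_prod[OF insert(4)] by auto
  ultimately have "polynomial (carrier R) (map f (linear_prod (insert y S)))"
    using set_linear_prod[OF insert(4)] unfolding polynomial_def
    by (cases "linear_prod (insert y S)") (simp_all only: list.map list.sel list.set, blast+)
  from normalize_polynomial[OF this]
  have "map f (linear_prod (insert y S)) = normalize (map f (poly_mult ?q (linear_prod S)))"
    unfolding lin by (rule sym)
  also have "\<dots> = poly_mult (map f ?q) (map f (linear_prod S))"
    by (rule f.poly_mult_hom') (use y set_linear_prod in auto)
  also have "\<dots> = poly_mult [\<one>, \<ominus> f y] (linear_prod (f ` S))"
    using insert.IH[OF y(2)] y by simp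
  also have "\<dots> = linear_prod (f ` insert y S)"
    using linear_prod_insert[OF _ fS notin] insert(1) by simp
  finally show ?case .
qed

end

context algebraic_closure_over
begin

lemma stable_Int:
  assumes A: "subfield A R" "K \<subseteq> A" and B: "subfield B R" "K \<subseteq> B" and E: "E \<subseteq> carrier R"
    and sA: "stable A E" and sB: "stable B E"
  shows "stable (A \<inter> B) E"
  unfolding stable_def
proof (intro ballI image_subsetI)
  fix \<tau> x assume \<tau>: "\<tau> \<in> Gal (A \<inter> B)" and x: "x \<in> E"
  let ?C = "A \<inter> B"
  have C: "subfield ?C R" "K \<subseteq> ?C" using subfield_Int A B by auto
  have xc: "x \<in> carrier R" using x E by blast
  note Irr = IrrE[OF C(1) xc algebraic_over[OF C(2) xc]]
  have p: "Irr ?C x \<in> carrier (poly_ring R)" "Irr ?C x \<noteq> []" "set (Irr ?C x) \<subseteq> ?C"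
    using carrier_polynomial_shell[OF subfieldE(1)[OF C(1)] Irr(1)]
      pirreducibleE(1)[OF subfieldE(1)[OF C(1)] Irr(1,2)] Irr(1) polynomial_incl univ_poly_carrier
    by (blast, blast, blast)
  \<comment> \<open>Only the conjugates inside \<open>E\<close> are taken, so membership in
    \<open>S\<close> gives back membership in \<open>E\<close>.\<close>
  define S where "S = { v \<in> E. is_root (Irr ?C x) v }"
  have S: "finite S" "S \<subseteq> carrier R"
    using finite_number_of_roots[OF p(1)] E unfolding S_def by auto
  have xS: "x \<in> S" unfolding S_def is_root_def using x xc Irr(4) p(2) by blast
  \<comment> \<open>This applies to \<open>Gal A\<close> and \<open>Gal B\<close>, but not to
    \<open>\<tau>\<close>, which is not yet known to preserve \<open>E\<close>;
    \<open>\<tau>\<close> is reached through the coefficients of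
    \<open>linear_prod S\<close>.\<close>
  have img: "\<rho> ` S = S" if \<rho>: "\<rho> \<in> Gal ?C" "\<rho> ` E \<subseteq> E" for \<rho>
  proof (rule endo_inj_surj[OF S(1)])
    show "\<rho> ` S \<subseteq> S"
      using \<rho> Gal_root[OF \<rho>(1) p(3) subfieldE(3)[OF C(1)]] Gal_closed[OF \<rho>(1)]
      unfolding S_def is_root_def by blast
    show "inj_on \<rho> S" using Gal_inj[OF \<rho>(1)] S(2) inj_on_subset by blast
  qed
  have fixed: "\<rho> c = c" if "\<rho> \<in> Gal ?C" "\<rho> ` E \<subseteq> E" "c \<in> set (linear_prod S)" for \<rho> c
  proof -
    have "map \<rho> (linear_prod S) = linear_prod S"
      using map_linear_prod[OF Gal_hom[OF that(1)] Gal_inj[OF that(1)] S] img[OF that(1,2)] by simp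
    thus ?thesis using that(3) map_eq_conv[of \<rho> "linear_prod S" id] by simp
  qed
  have GA: "\<rho> \<in> Gal ?C" "\<rho> ` E \<subseteq> E" if "\<rho> \<in> Gal A" for \<rho>
    using that Gal_antimono[of ?C A] sA unfolding stable_def by auto
  have GB: "\<rho> \<in> Gal ?C" "\<rho> ` E \<subseteq> E" if "\<rho> \<in> Gal B" for \<rho>
    using that Gal_antimono[of ?C B] sB unfolding stable_def by auto
  have "\<tau> c = c" if c: "c \<in> set (linear_prod S)" for c
  proof (rule fixed_by_Gal_Int[OF A B _ _ _ \<tau>])
    show "c \<in> carrier R" using c set_linear_prod[OF S(2)] by blast
    show "\<forall>\<rho> \<in> Gal A. \<rho> c = c" "\<forall>\<rho> \<in> Gal B. \<rho> c = c" using fixed[OF _ _ c] GA GB by blast+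
  qed
  hence map: "map \<tau> (linear_prod S) = linear_prod S" by (auto intro: map_idI)
  interpret \<tau>: ring_hom_ring R R \<tau> by (rule Gal_hom[OF \<tau>])
  have "eval (linear_prod S) x = \<zero>" using eval_linear_prod[OF S xc] xS by blast
  hence "eval (linear_prod S) (\<tau> x) = \<zero>"
    using \<tau>.eval_hom'[OF xc set_linear_prod[OF S(2)]] map by simp
  hence "\<tau> x \<in> S" using eval_linear_prod[OF S Gal_closed[OF \<tau> xc]] by blast
  thus "\<tau> x \<in> E" unfolding S_def by blast
qed

end

section \<open>Linear disjointness and composita\<close>

context field
begin

lemma combine_in_subring:
  assumes "subring T R" "set Ks \<subseteq> T" "set Us \<subseteq> T" shows "combine Ks Us \<in> T"
  using assms(2,3) by (induction Ks Us rule: combine.induct) (auto simp: subringE[OF assms(1)])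

lemma Span_mono_field:
  assumes "subfield A R" "subfield B R" "A \<subseteq> B" "set Us \<subseteq> carrier R"
  shows "Span A Us \<subseteq> Span B Us"
  unfolding Span_eq_combine_set[OF assms(1,4)] Span_eq_combine_set[OF assms(2,4)]
  using assms(3) by blast

lemma Span_subset_subring:
  assumes "subfield A R" "subring T R" "A \<subseteq> T" "set Us \<subseteq> T"
  shows "Span A Us \<subseteq> T"
proof -
  have "set Us \<subseteq> carrier R" using assms(4) subringE(1)[OF assms(2)] by blast
  hence "Span A Us = { combine Ks Us | Ks. set Ks \<subseteq> A }"
    by (rule Span_eq_combine_set[OF assms(1)])
  thus ?thesis
    using combine_in_subring[OF assms(2) order_trans[OF _ assms(3)] assms(4)] by auto
qed

text \<open>Reduces closure of a span under multiplication by \<open>w\<close> to the products of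
  \<open>w\<close> with the generators.\<close>

lemma combine_mult_in_Span:
  assumes "subfield B R" "set Us \<subseteq> carrier R" "w \<in> carrier R"
    and "set Ks \<subseteq> B" "set Vs \<subseteq> carrier R" "\<And>v. v \<in> set Vs \<Longrightarrow> v \<otimes> w \<in> Span B Us"
  shows "combine Ks Vs \<otimes> w \<in> Span B Us"
  using assms(4-)
proof (induction Ks Vs rule: combine.induct)
  case (1 k Ks v Vs)
  have c: "k \<in> carrier R" "v \<in> carrier R" "combine Ks Vs \<in> carrier R"
    using 1(2,3) subfieldE(3)[OF assms(1)] by (auto intro!: combine_in_carrier)
  have "combine (k # Ks) (v # Vs) \<otimes> w = k \<otimes> (v \<otimes> w) \<oplus> combine Ks Vs \<otimes> w"
    using c assms(3) by (simp add: l_distr m_assoc)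
  moreover have "k \<otimes> (v \<otimes> w) \<in> Span B Us"
    using Span_smult_closed[OF assms(1,2)] 1(2,4) by simp
  moreover have "combine Ks Vs \<otimes> w \<in> Span B Us" using 1 by simp
  ultimately show ?case using Span_subgroup_props(3)[OF assms(1,2)] by metis
qed (use assms(3) Span_subgroup_props(2)[OF assms(1,2)] in simp_all)

section \<open>Degrees in towers of finite extensions\<close>

lemma subfield_imp_subalgebra:
  assumes "subfield N R" "A \<subseteq> N" shows "subalgebra A N R"
proof -
  note sub = subfieldE(1)[OF assms(1)]
  show ?thesis
    by (intro subalgebra.intro subalgebra_axioms.intro)
      (use subring.axioms(1)[OF sub] subringE(6)[OF sub] assms(2) in auto)
qed

text \<open>A basis of \<open>E\<close> over \<open>A\<close> still spans \<open>E\<close> over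
  \<open>N\<close>, which gives finiteness of the upper step.\<close>

lemma finite_dimension_tower:
  assumes A: "subfield A R" and N: "subfield N R" and E: "subfield E R" and sub: "A \<subseteq> N" "N \<subseteq> E"
    and fin: "finite_dimension A E"
  shows "finite_dimension A N" "finite_dimension N E" "(dim over A) E = (dim over A) N * (dim over N) E"
proof -
  show AN: "finite_dimension A N"
    using subalbegra_incl_imp_finite_dimension[OF A fin subfield_imp_subalgebra[OF N sub(1)] sub(2)] .
  obtain n where "dimension n A E" using fin unfolding finite_dimension_def by blast
  then obtain Us where Us: "set Us \<subseteq> carrier R" "Span A Us = E" using exists_base[OF A] by blast
  have "set Us \<subseteq> E" using Span_base_incl[OF A Us(1)] Us(2) by blast
  hence "Span N Us = E"
    using Span_mono_field[OF A N sub(1) Us(1)] Span_subset_subring[OF N subfieldE(1)[OF E] sub(2)] Us(2) by blast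
  thus NE: "finite_dimension N E" using Span_finite_dimension[OF N Us(1)] by simp
  show "(dim over A) E = (dim over A) N * (dim over N) E"
    using telescopic_base_dim(2)[OF A N AN NE] .
qed

lemma dim_pos:
  assumes "subfield A R" "subfield E R" "finite_dimension A E" shows "(dim over A) E > 0"
proof (rule ccontr)
  assume "\<not> (dim over A) E > 0"
  hence "dimension 0 A E" using finite_dimensionE[OF assms(1,3)] by simp
  hence "E = {\<zero>}" using dimension_zero[OF assms(1)] by blast
  thus False using subringE(3)[OF subfieldE(1)[OF assms(2)]] by simp
qed

lemma dim_one_imp_eq:
  assumes A: "subfield A R" and N: "subfield N R" "A \<subseteq> N" and "finite_dimension A N" "(dim over A) N = 1"
  shows "N = A"
proof -
  have d: "dimension 1 A N" using finite_dimensionE[OF A assms(4)] assms(5) by simp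
  have "independent A [\<one>]" by (intro li_Cons) auto
  hence "Span A [\<one>] = N"
    using independent_length_eq_dimension[OF A d, of "[\<one>]"] subringE(3)[OF subfieldE(1)[OF N(1)]] by simp
  moreover have "Span A [\<one>] \<subseteq> A"
    by (rule Span_subset_subring[OF A subfieldE(1)[OF A]]) (use subringE(3)[OF subfieldE(1)[OF A]] in auto)
  ultimately show ?thesis using N(2) by blast
qed

text \<open>By the tower formula the degree of \<open>N'\<close> over \<open>N\<close> is at most
  one. This turns maximality of a degree into equality of comparable fields.\<close>

lemma eq_of_dim_le:
  assumes N: "subfield N R" and N': "subfield N' R" and E: "subfield E R" and sub: "N \<subseteq> N'" "N' \<subseteq> E"
    and fin: "finite_dimension N E" and le: "(dim over N) E \<le> (dim over N') E"
  shows "N' = N"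
proof -
  note tower = finite_dimension_tower[OF N N' E sub fin]
  have "(dim over N) N' * (dim over N') E \<le> 1 * (dim over N') E" using le tower(3) by simp
  hence "(dim over N) N' \<le> 1" using dim_pos[OF N' E tower(2)] by simp
  hence "(dim over N) N' = 1" using dim_pos[OF N N' tower(1)] by linarith
  thus ?thesis using dim_one_imp_eq[OF N N' sub(1) tower(1)] by blast
qed

section \<open>Composita and linear disjointness\<close>

lemma compositum_commute: "compositum A B = compositum B A"
  unfolding compositum_def by (simp add: Un_commute)

lemma compositum_props:
  assumes "A \<subseteq> carrier R" "B \<subseteq> carrier R"
  shows "subfield (compositum A B) R" "A \<subseteq> compositum A B" "B \<subseteq> compositum A B"
  unfolding compositum_def using generate_fieldE(1,2)[of "A \<union> B"] assms by auto

lemma compositum_least: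
  assumes "subfield E R" "A \<subseteq> E" "B \<subseteq> E" shows "compositum A B \<subseteq> E"
  unfolding compositum_def
  using generate_field_min_subfield1[OF _ assms(1), of "A \<union> B"] assms(2,3)
    order_trans[OF assms(2) subfieldE(3)[OF assms(1)]] order_trans[OF assms(3) subfieldE(3)[OF assms(1)]]
  by (simp only: Un_least)

lemma compositum_mono:
  assumes "A \<subseteq> A'" "B \<subseteq> B'" "A' \<subseteq> carrier R" "B' \<subseteq> carrier R"
  shows "compositum A B \<subseteq> compositum A' B'"
  unfolding compositum_def using mono_generate_field[of "A \<union> B" "A' \<union> B'"] assms by auto

end

context algebraic_closure_over
begin

text \<open>The span is closed under multiplication, hence a subring; lying between \<open>K\<close>
  and \<open>R\<close>, it is algebraic over \<open>K\<close> and therefore a field.\<close>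

lemma compositum_eq_Span:
  assumes A: "subfield A R" "K \<subseteq> A" and B: "subfield B R" "K \<subseteq> B"
    and Us: "set Us \<subseteq> carrier R" "Span K Us = A"
  shows "compositum A B = Span B Us"
proof
  let ?S = "Span B Us"
  note subA = subfieldE(1)[OF A(1)] and subB = subfieldE(1)[OF B(1)]
  have Ac: "A \<subseteq> carrier R" and Bc: "B \<subseteq> carrier R" using A(1) B(1) subfieldE(3) by auto
  have UA: "set Us \<subseteq> A" using Span_base_incl[OF subfield_axioms Us(1)] Us(2) by blast
  have AS: "A \<subseteq> ?S" using Span_mono_field[OF subfield_axioms B Us(1)] Us(2) by blast
  have Sc: "?S \<subseteq> carrier R" using Span_in_carrier[OF Bc Us(1)] .
  \<comment> \<open>Closure under products takes two rounds: first with one factor in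
    \<open>A\<close>, where generators times \<open>a\<close> stay in \<open>A\<close>, then for a
    general factor by linearity and commutativity.\<close>
  have multA: "v \<otimes> a \<in> ?S" if v: "v \<in> ?S" and a: "a \<in> A" for v a
  proof -
    obtain Ks where "set Ks \<subseteq> B" "v = combine Ks Us"
      using v Span_eq_combine_set[OF B(1) Us(1)] by blast
    moreover have "u \<otimes> a \<in> ?S" if "u \<in> set Us" for u
      using subringE(6)[OF subA, of u a] that a UA AS by auto
    ultimately show ?thesis
      using combine_mult_in_Span[OF B(1) Us(1) _ _ Us(1), of a Ks] a Ac by auto
  qed
  have mult: "v \<otimes> w \<in> ?S" if v: "v \<in> ?S" and w: "w \<in> ?S" for v w
  proof -
    obtain Ks where Ks: "set Ks \<subseteq> B" "v = combine Ks Us"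
      using v Span_eq_combine_set[OF B(1) Us(1)] by blast
    have "u \<otimes> w \<in> ?S" if u: "u \<in> set Us" for u
    proof -
      have "w \<otimes> u \<in> ?S" using multA[OF w] u UA by blast
      moreover have "w \<otimes> u = u \<otimes> w" using m_comm Sc Us(1) u w by blast
      ultimately show ?thesis by simp
    qed
    thus ?thesis
      using combine_mult_in_Span[OF B(1) Us(1) _ Ks(1) Us(1), of w] Ks(2) Sc w by auto
  qed
  have "subring ?S R"
  proof (rule subringI)
    show "\<one> \<in> ?S" using subringE(3)[OF subA] AS by blast
  qed (use Sc mult Span_subgroup_props[OF B(1) Us(1)] in auto)
  hence "subfield ?S R" using subring_imp_subfield A(2) AS by blast
  moreover have "B \<subseteq> ?S"
  proof
    fix b assume b: "b \<in> B"
    have "b \<otimes> \<one> \<in> ?S" using Span_smult_closed[OF B(1) Us(1) b] subringE(3)[OF subA] AS by blast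
    thus "b \<in> ?S" using b Bc by auto
  qed
  ultimately show "compositum A B \<subseteq> ?S" using compositum_least AS by blast
  note C = compositum_props[OF Ac Bc]
  show "?S \<subseteq> compositum A B"
    using Span_subset_subring[OF B(1) subfieldE(1)[OF C(1)] C(3)] UA C(2) by blast
qed

text \<open>
  Collects a \<open>P\<close>-combination of \<open>Vs\<close> along a \<open>K\<close>-independent family of \<open>P\<close>; its last member is \<open>\<one>\<close> so
  that an element of \<open>Q\<close> has the trivial expansion concentrated there.
\<close>

lemma combine_regroup:
  assumes P: "subfield P R" and Q: "subfield Q R" "K \<subseteq> Q"
    and "set ls \<subseteq> P" "set Vs \<subseteq> Q"
  shows "\<exists>Us ws. independent K (Us @ [\<one>]) \<and> set Us \<subseteq> P \<and> set ws \<subseteq> Span K Vs \<and>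
    length ws = Suc (length Us) \<and> combine ls Vs = combine ws (Us @ [\<one>])"
proof -
  have base: "\<exists>Us ws. independent K (Us @ [\<one>]) \<and> set Us \<subseteq> P \<and> set ws \<subseteq> Span K Vs \<and>
    length ws = Suc (length Us) \<and> \<zero> = combine ws (Us @ [\<one>])" if "set Vs \<subseteq> Q" for Vs
  proof -
    have "independent K [\<one>]" by (intro li_Cons) auto
    moreover have "\<zero> \<in> Span K Vs"
      using Span_subgroup_props(2)[OF subfield_axioms] that subfieldE(3)[OF Q(1)] by blast
    ultimately show ?thesis by (intro exI[of _ "[]"] exI[of _ "[\<zero>]"]) simp
  qed
  show ?thesis using assms(4,5)
  proof (induction ls Vs rule: combine.induct)
    case (1 l ls v Vs)
    have Qc: "Q \<subseteq> carrier R" using subfieldE(3)[OF Q(1)] .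
    have c: "l \<in> carrier R" "v \<in> carrier R" "set (v # Vs) \<subseteq> carrier R" "set Vs \<subseteq> carrier R"
      using 1(2,3) subfieldE(3)[OF P] Qc by auto
    let ?S = "Span K (v # Vs)"
    note S = Span_subgroup_props[OF subfield_axioms c(3)] Span_smult_closed[OF subfield_axioms c(3)]
    obtain Us ws where IH: "independent K (Us @ [\<one>])" "set Us \<subseteq> P" "set ws \<subseteq> Span K Vs"
      "length ws = Suc (length Us)" "combine ls Vs = combine ws (Us @ [\<one>])"
      using 1 by auto
    have UO: "set (Us @ [\<one>]) \<subseteq> carrier R" using independent_in_carrier[OF IH(1)] .
    have ws: "set ws \<subseteq> ?S" using IH(3) mono_Span[OF subfield_axioms c(4,2)] by blast
    have wsc: "set ws \<subseteq> carrier R" using ws S(1) by blast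
    have v: "v \<in> ?S" using Span_base_incl[OF subfield_axioms c(3)] by simp
    show ?case
    \<comment> \<open>If \<open>l\<close> depends on the family, \<open>l \<otimes> v\<close> is
      distributed over the existing coefficients; otherwise \<open>l\<close> joins the family with
      coefficient \<open>v\<close>.\<close>
    proof (cases "l \<in> Span K (Us @ [\<one>])")
      case True
      then obtain ks where ks: "set ks \<subseteq> K" "length ks = length (Us @ [\<one>])" "l = combine ks (Us @ [\<one>])"
        using Span_mem_iff_length_version[OF subfield_axioms UO] by blast
      have ksc: "set ks \<subseteq> carrier R" using ks(1) subfieldE(3)[OF subfield_axioms] by blast
      let ?vs = "map ((\<otimes>) v) ks"
      have vs: "set ?vs \<subseteq> ?S"
      proof
        fix y assume "y \<in> set ?vs"
        then obtain k where k: "k \<in> set ks" "y = v \<otimes> k" by auto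
        hence "y = k \<otimes> v" using m_comm c(2) ksc by blast
        thus "y \<in> ?S" using S(5)[OF _ v] k(1) ks(1) by blast
      qed
      have vsc: "set ?vs \<subseteq> carrier R" using vs S(1) by blast
      have "l \<otimes> v = combine ?vs (Us @ [\<one>])"
        using combine_r_distr[OF ksc UO c(2)] ks(3) m_comm[OF c(1,2)] by simp
      hence "combine (l # ls) (v # Vs) = combine (map2 (\<oplus>) ?vs ws) (Us @ [\<one>])"
        using combine_add[OF _ _ vsc wsc UO] ks(2) IH(4,5) by simp
      moreover have "set (map2 (\<oplus>) ?vs ws) \<subseteq> ?S"
      proof
        fix y assume "y \<in> set (map2 (\<oplus>) ?vs ws)"
        then obtain a b where ab: "(a, b) \<in> set (zip ?vs ws)" "y = a \<oplus> b"
          by (metis (no_types, lifting) case_prod_conv imageE list.set_map surj_pair)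
        have "a \<in> ?S" "b \<in> ?S"
          using subsetD[OF vs set_zip_leftD[OF ab(1)]] subsetD[OF ws set_zip_rightD[OF ab(1)]] .
        thus "y \<in> ?S" unfolding ab(2) by (rule S(3))
      qed
      ultimately show ?thesis
        using IH(1,2,4) ks(2) by (intro exI[of _ Us] exI[of _ "map2 (\<oplus>) ?vs ws"]) simp
    next
      case False
      hence "independent K ((l # Us) @ [\<one>])" using IH(1) c(1) by (simp add: li_Cons)
      moreover have "combine (l # ls) (v # Vs) = combine (v # ws) ((l # Us) @ [\<one>])"
        using IH(5) m_comm[OF c(1,2)] by simp
      ultimately show ?thesis
        using IH(2,4) 1(2) v ws by (intro exI[of _ "l # Us"] exI[of _ "v # ws"]) simp
    qed
  next
    case ("2_1" Vs) show ?case using base "2_1" by simp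
  next
    case ("2_2" ls) show ?case using base[of "[]"] by simp
  qed
qed

text \<open>The definition is asymmetric in its last two arguments. It suffices that an element
  \<open>x\<close> of \<open>Q\<close> in the \<open>P\<close>-span of \<open>Vs\<close> is in the
  \<open>K\<close>-span (\<open>key\<close>): regroup \<open>x\<close> along a family that stays
  independent over \<open>Q\<close>; by uniqueness the result is the trivial expansion
  \<open>?zs\<close>, so \<open>x\<close> is the last coefficient and lies in
  \<open>Span K Vs\<close>.\<close>

lemma linearly_disjoint_sym:
  assumes P: "subfield P R" "K \<subseteq> P" and Q: "subfield Q R" "K \<subseteq> Q" and ld: "linearly_disjoint K P Q"
  shows "linearly_disjoint K Q P"
proof -
  have Qc: "Q \<subseteq> carrier R" using subfieldE(3)[OF Q(1)] .
  have key: "x \<in> Span K Vs" if Vs: "set Vs \<subseteq> Q" and x: "x \<in> Span P Vs" "x \<in> Q" for x Vs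
  proof -
    have Vc: "set Vs \<subseteq> carrier R" using Vs Qc by blast
    obtain ls where "set ls \<subseteq> P" "x = combine ls Vs"
      using x(1) Span_eq_combine_set[OF P(1) Vc] by blast
    then obtain Us ws where U: "independent K (Us @ [\<one>])" "set Us \<subseteq> P" "set ws \<subseteq> Span K Vs"
      "length ws = Suc (length Us)" "x = combine ws (Us @ [\<one>])"
      using combine_regroup[OF P(1) Q _ Vs] by metis
    have xc: "x \<in> carrier R" using x(2) Qc by blast
    have UO: "set (Us @ [\<one>]) \<subseteq> carrier R" using independent_in_carrier[OF U(1)] .
    have "set (Us @ [\<one>]) \<subseteq> P" using U(2) subringE(3)[OF subfieldE(1)[OF P(1)]] by simp
    hence ind: "independent Q (Us @ [\<one>])" using ld U(1) unfolding linearly_disjoint_def by blast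
    let ?zs = "replicate (length Us) \<zero> @ [x]"
    have zs: "set ?zs \<subseteq> Q" using x(2) subringE(2)[OF subfieldE(1)[OF Q(1)]] by auto
    have xz: "x = combine ?zs (Us @ [\<one>])"
      using combine_prepend_replicate[of "[x]" "Us @ [\<one>]" "length Us"] xc UO by simp
    have "set ws \<subseteq> Q"
      using U(3) Span_subset_subring[OF subfield_axioms subfieldE(1)[OF Q(1)] Q(2) Vs] by blast
    moreover have "x \<in> Span Q (Us @ [\<one>])"
      unfolding Span_eq_combine_set[OF Q(1) UO] using zs xz by blast
    ultimately have "ws = ?zs"
      using unique_decomposition[OF Q(1) ind] U(4,5) zs xz by (metis length_append_singleton length_replicate)
    thus ?thesis using U(3) by auto
  qed
  have "independent P Us" if "independent K Us" "set Us \<subseteq> Q" for Us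
    using that
  proof (induction Us rule: list.induct)
    case (Cons u Us)
    note ind = independent_backwards[OF Cons.prems(1)]
    have "u \<notin> Span P Us" using key[of Us u] ind(1) Cons.prems(2) by auto
    thus ?case using Cons ind(2,3) by (intro li_Cons) auto
  qed (rule li_Nil)
  thus ?thesis unfolding linearly_disjoint_def by blast
qed

text \<open>An \<open>x\<close> in both fields depends over \<open>Q\<close> on a
  \<open>K\<close>-basis of \<open>A\<close>. All these elements lie in \<open>P\<close>, so by
  disjointness the dependence already holds over \<open>K\<close>, and \<open>x\<close> is in
  \<open>A\<close>.\<close>

lemma compositum_Int_left:
  assumes P: "subfield P R" "K \<subseteq> P" and Q: "subfield Q R" "K \<subseteq> Q" and ld: "linearly_disjoint K P Q"
    and A: "subfield A R" "K \<subseteq> A" "A \<subseteq> P" "finite_dimension K A" and B: "subfield B R" "K \<subseteq> B" "B \<subseteq> Q"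
  shows "compositum A B \<inter> P = A"
proof
  obtain n where "dimension n K A" using A(4) unfolding finite_dimension_def by blast
  then obtain Us where Us: "set Us \<subseteq> carrier R" "independent K Us" "Span K Us = A"
    using exists_base[OF subfield_axioms] by blast
  have UA: "set Us \<subseteq> A" using Span_base_incl[OF subfield_axioms Us(1)] Us(3) by blast
  show "compositum A B \<inter> P \<subseteq> A"
  proof
    fix x assume x: "x \<in> compositum A B \<inter> P"
    hence "x \<in> Span Q Us"
      using compositum_eq_Span[OF A(1,2) B(1,2) Us(1,3)] Span_mono_field[OF B(1) Q(1) B(3) Us(1)] by blast
    hence "\<not> independent Q (x # Us)" using independent_backwards(1) by blast
    hence "\<not> independent K (x # Us)"
      using ld x UA A(3) unfolding linearly_disjoint_def by auto
    thus "x \<in> A" using Us(2,3) x subfieldE(3)[OF P(1)] by (auto intro: li_Cons)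
  qed
  show "A \<subseteq> compositum A B \<inter> P"
    using compositum_props(2)[of A B] A(1,3) B(1) subfieldE(3) by blast
qed

end

section \<open>Normal extensions of composita\<close>

definition (in ring) finite_intermediate :: "'a set \<Rightarrow> 'a set \<Rightarrow> 'a set \<Rightarrow> bool"
  where "finite_intermediate K P A \<longleftrightarrow> intermediate_field K P A \<and> finite_dimension K A"

text \<open>The degree-free form of \<open>unique_max_normal_over\<close>; inclusions transfer to
  composita directly.\<close>

definition (in ring) least_normal_base :: "'a set \<Rightarrow> 'a set \<Rightarrow> 'a set \<Rightarrow> bool"
  where "least_normal_base K E N \<longleftrightarrow>
    intermediate_field K E N \<and> normal_ext N E \<and>
    (\<forall>N'. intermediate_field K E N' \<and> normal_ext N' E \<longrightarrow> N \<subseteq> N')"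

lemma (in ring) finite_intermediateD:
  assumes "finite_intermediate K P A"
  shows "subfield A R" "K \<subseteq> A" "A \<subseteq> P" "finite_dimension K A" "A \<subseteq> carrier R"
  using assms subfieldE(3) unfolding finite_intermediate_def intermediate_field_def by auto

text \<open>An automorphism fixing the compositum of \<open>A\<close> and \<open>B\<close> fixes
  both, so it preserves the generators \<open>L \<union> J\<close>; the rest is induction on field
  generation.\<close>

lemma (in field) stable_compositum:
  assumes c: "A \<subseteq> carrier R" "B \<subseteq> carrier R" "L \<subseteq> carrier R" "J \<subseteq> carrier R"
    and st: "stable A L" "stable B J"
  shows "stable (compositum A B) (compositum L J)"
  unfolding stable_def
proof (intro ballI image_subsetI)
  fix \<tau> x assume \<tau>: "\<tau> \<in> Gal (compositum A B)" and x: "x \<in> compositum L J"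
  have \<tau>A: "\<tau> \<in> Gal A" and \<tau>B: "\<tau> \<in> Gal B"
    using subsetD[OF Gal_antimono \<tau>] compositum_props(2,3)[OF c(1,2)] by auto
  interpret \<tau>: ring_hom_ring R R \<tau> by (rule Gal_hom[OF \<tau>])
  note C = compositum_props[OF c(3,4)]
  have LJ: "L \<union> J \<subseteq> carrier R" using c by simp
  have closed: "h \<in> carrier R" if "h \<in> generate_field R (L \<union> J)" for h
    using generate_field_in_carrier[OF LJ that] .
  from x have "x \<in> generate_field R (L \<union> J)" unfolding compositum_def .
  hence "\<tau> x \<in> generate_field R (L \<union> J)"
  proof (induction rule: generate_field.induct)
    case one thus ?case using generate_field.one by simp
  next
    case (incl h)
    have "\<tau> h \<in> L \<union> J" using incl stableD[OF st(1) \<tau>A] stableD[OF st(2) \<tau>B] by (metis Un_iff)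
    thus ?case by (rule generate_field.incl)
  next
    case (a_inv h) thus ?case using closed[OF a_inv(1)] generate_field.a_inv by simp
  next
    case (m_inv h)
    have hc: "h \<in> carrier R" "inv h \<in> carrier R" "h \<otimes> inv h = \<one>"
      using closed[OF m_inv(1)] m_inv(2) field_Units by auto
    have mul: "\<tau> h \<otimes> \<tau> (inv h) = \<one>" using \<tau>.hom_mult[OF hc(1,2)] hc(3) by simp
    hence "\<tau> (inv h) = inv (\<tau> h)" using comm_inv_char[of "\<tau> h" "\<tau> (inv h)"] hc(1,2) by simp
    moreover have "\<tau> h \<noteq> \<zero>" using mul hc(2) by auto
    ultimately show ?case using m_inv(3) generate_field.m_inv by metis
  next
    case (eng_add h1 h2) thus ?case using closed generate_field.eng_add by simp
  next
    case (eng_mult h1 h2) thus ?case using closed generate_field.eng_mult by simp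
  qed
  thus "\<tau> x \<in> compositum L J" unfolding compositum_def .
qed

context algebraic_closure_over
begin

lemma finite_intermediate_sub:
  assumes E: "finite_intermediate K P E" and N: "intermediate_field K E N"
  shows "finite_intermediate K P N" "finite_dimension N E"
proof -
  note E' = finite_intermediateD[OF E]
  have N': "subfield N R" "K \<subseteq> N" "N \<subseteq> E" using N unfolding intermediate_field_def by auto
  note tower = finite_dimension_tower[OF subfield_axioms N'(1) E'(1) N'(2,3) E'(4)]
  show "finite_intermediate K P N"
    unfolding finite_intermediate_def intermediate_field_def using N' E'(3) tower(1) by auto
  show "finite_dimension N E" using tower(2) .
qed

lemma normal_extD:
  assumes "normal_ext A E" "K \<subseteq> A"
  shows "subfield A R" "subfield E R" "A \<subseteq> E" "stable A E"
proof -
  show A: "subfield A R" using assms(1) unfolding normal_ext_def by blast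
  show "subfield E R" "A \<subseteq> E" "stable A E"
    using normal_ext_iff_stable[OF A assms(2)] assms(1) by simp_all
qed

lemma normal_extI:
  assumes "subfield A R" "K \<subseteq> A" "subfield E R" "A \<subseteq> E" "stable A E"
  shows "normal_ext A E"
  using normal_ext_iff_stable[OF assms(1,2)] assms(3-5) by simp

text \<open>By \<open>stable_Int\<close>, \<open>E\<close> is normal over
  \<open>N \<inter> N'\<close> whenever it is normal over \<open>N\<close> and \<open>N'\<close>;
  the degree cannot grow past the maximum, so \<open>N = N \<inter> N'\<close>. Conversely, a least
  base has the maximal degree by the tower formula, and equal degree forces equality.\<close>

lemma unique_max_normal_over_iff:
  assumes fin: "finite_field_ext K E"
  shows "unique_max_normal_over K E N \<longleftrightarrow> least_normal_base K E N"
proof -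
  have E: "subfield E R" "K \<subseteq> E" and fE: "finite_intermediate K E E"
    using fin unfolding finite_field_ext_def finite_intermediate_def intermediate_field_def by auto
  have Ec: "E \<subseteq> carrier R" using subfieldE(3)[OF E(1)] .
  show ?thesis
  proof
    assume u: "unique_max_normal_over K E N"
    hence N: "intermediate_field K E N" "normal_ext N E"
      and max: "\<And>N'. \<lbrakk> intermediate_field K E N'; normal_ext N' E \<rbrakk> \<Longrightarrow> (dim over N') E \<le> (dim over N) E"
      unfolding unique_max_normal_over_def max_normal_over_def by auto
    have KN: "subfield N R" "K \<subseteq> N" "N \<subseteq> E" using N(1) unfolding intermediate_field_def by auto
    have "N \<subseteq> N'" if N': "intermediate_field K E N'" "normal_ext N' E" for N'
    proof -
      have KN': "subfield N' R" "K \<subseteq> N'" "N' \<subseteq> E" using N'(1) unfolding intermediate_field_def by auto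
      have I: "subfield (N \<inter> N') R" "K \<subseteq> N \<inter> N'" "N \<inter> N' \<subseteq> E"
        using subfield_Int[OF KN(1) KN'(1)] KN KN' by auto
      have iI: "intermediate_field K E (N \<inter> N')" unfolding intermediate_field_def using I by simp
      have "stable (N \<inter> N') E"
        using stable_Int[OF KN(1,2) KN'(1,2) Ec] normal_extD(4)[OF N(2) KN(2)] normal_extD(4)[OF N'(2) KN'(2)] .
      hence "normal_ext (N \<inter> N') E" by (rule normal_extI[OF I(1,2) E(1) I(3)])
      hence "(dim over (N \<inter> N')) E \<le> (dim over N) E" using max[OF iI] by simp
      hence "N = N \<inter> N'"
        using eq_of_dim_le[OF I(1) KN(1) E(1) Int_lower1 KN(3) finite_intermediate_sub(2)[OF fE iI]] by simp
      thus ?thesis by auto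
    qed
    thus "least_normal_base K E N" unfolding least_normal_base_def using N by simp
  next
    assume l: "least_normal_base K E N"
    hence N: "intermediate_field K E N" "normal_ext N E"
      and least: "\<And>N'. \<lbrakk> intermediate_field K E N'; normal_ext N' E \<rbrakk> \<Longrightarrow> N \<subseteq> N'"
      unfolding least_normal_base_def by auto
    have KN: "subfield N R" "K \<subseteq> N" "N \<subseteq> E" using N(1) unfolding intermediate_field_def by auto
    note finN = finite_intermediate_sub(2)[OF fE N(1)]
    have le: "(dim over N') E \<le> (dim over N) E" if N': "intermediate_field K E N'" "normal_ext N' E" for N'
    proof -
      have KN': "subfield N' R" "N' \<subseteq> E" using N'(1) unfolding intermediate_field_def by auto
      note tower = finite_dimension_tower[OF KN(1) KN'(1) E(1) least[OF N'] KN'(2) finN]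
      show ?thesis using tower(3) dim_pos[OF KN(1) KN'(1) tower(1)] by simp
    qed
    have "N' = N" if m: "max_normal_over K E N'" for N'
    proof -
      have N': "intermediate_field K E N'" "normal_ext N' E" "(dim over N) E \<le> (dim over N') E"
        using m N unfolding max_normal_over_def by auto
      have KN': "subfield N' R" "N' \<subseteq> E" using N'(1) unfolding intermediate_field_def by auto
      show ?thesis using eq_of_dim_le[OF KN(1) KN'(1) E(1) least[OF N'(1,2)] KN'(2) finN N'(3)] .
    qed
    thus "unique_max_normal_over K E N"
      unfolding unique_max_normal_over_def max_normal_over_def using N le by simp
  qed
qed

end

text \<open>\<open>P\<close> and \<open>Q\<close> will be the normal closures of \<open>L\<close>
  and \<open>J\<close>. The setting is symmetric, so \<open>swap\<close> yields every one-sided fact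
  for the other side as well.\<close>

locale disjoint_normal_pair = algebraic_closure_over R K for R (structure) and K +
  fixes P Q
  assumes P: "subfield P R" "K \<subseteq> P" "stable K P"
    and Q: "subfield Q R" "K \<subseteq> Q" "stable K Q"
    and disjoint: "linearly_disjoint K P Q"
begin

lemma swap: "disjoint_normal_pair R K Q P"
  by (intro disjoint_normal_pair.intro disjoint_normal_pair_axioms.intro algebraic_closure_over_axioms
      P Q linearly_disjoint_sym[OF P(1,2) Q(1,2) disjoint])

lemma compositum_Int:
  assumes A: "finite_intermediate K P A" and B: "finite_intermediate K Q B"
  shows "compositum A B \<inter> P = A" "compositum A B \<inter> Q = B"
proof -
  note A' = finite_intermediateD[OF A] and B' = finite_intermediateD[OF B]
  show "compositum A B \<inter> P = A"
    by (rule compositum_Int_left[OF P(1,2) Q(1,2) disjoint A'(1-4) B'(1-3)])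
  have "compositum B A \<inter> Q = B"
    by (rule compositum_Int_left[OF Q(1,2) P(1,2) linearly_disjoint_sym[OF P(1,2) Q(1,2) disjoint] B'(1-4) A'(1-3)])
  thus "compositum A B \<inter> Q = B" by (simp add: compositum_commute)
qed

text \<open>Automorphisms over \<open>N\<close> keep \<open>A\<close> inside both
  \<open>compositum A B\<close> and \<open>P\<close>, whose intersection is \<open>A\<close>. Then
  \<open>stable_Int\<close> is applied to \<open>N\<close> and to \<open>A\<close> itself, over
  which \<open>A\<close> is trivially stable.\<close>

lemma stable_left_component:
  assumes A: "finite_intermediate K P A" and B: "finite_intermediate K Q B"
    and N: "subfield N R" "K \<subseteq> N" "stable N (compositum A B)"
  shows "stable (N \<inter> A) A"
proof -
  note A' = finite_intermediateD[OF A] and B' = finite_intermediateD[OF B]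
  have "stable N A"
    unfolding stable_def
  proof (intro ballI image_subsetI)
    fix \<tau> x assume \<tau>: "\<tau> \<in> Gal N" and x: "x \<in> A"
    have "\<tau> x \<in> compositum A B"
      using stableD[OF N(3) \<tau>] x compositum_props(2)[OF A'(5) B'(5)] by (simp add: subsetD)
    moreover have "\<tau> x \<in> P"
      using stableD[OF stable_mono[OF P(3) N(2)] \<tau> subsetD[OF A'(3) x]] .
    ultimately show "\<tau> x \<in> A" using compositum_Int(1)[OF A B] by (metis IntI)
  qed
  thus ?thesis using stable_Int[OF N(1,2) A'(1,2,5)] stable_self by simp
qed

text \<open>For any competitor \<open>N\<close>, the fields \<open>N \<inter> A\<close> and
  \<open>N \<inter> B\<close> are bases over which \<open>A\<close> and \<open>B\<close> are normal,
  so they contain \<open>A'\<close> and \<open>B'\<close>.\<close>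

lemma least_normal_base_compositum:
  assumes A: "finite_intermediate K P A" and B: "finite_intermediate K Q B"
    and lA: "least_normal_base K A A'" and lB: "least_normal_base K B B'"
  shows "least_normal_base K (compositum A B) (compositum A' B')"
proof -
  interpret S: disjoint_normal_pair R K Q P by (rule swap)
  note fA = finite_intermediateD[OF A] and fB = finite_intermediateD[OF B]
  have A': "intermediate_field K A A'" "normal_ext A' A" and B': "intermediate_field K B B'" "normal_ext B' B"
    using lA lB unfolding least_normal_base_def by auto
  note fA' = finite_intermediateD[OF finite_intermediate_sub(1)[OF A A'(1)]]
    and fB' = finite_intermediateD[OF finite_intermediate_sub(1)[OF B B'(1)]]
  have sub: "A' \<subseteq> A" "B' \<subseteq> B" using A'(1) B'(1) unfolding intermediate_field_def by auto
  note C = compositum_props[OF fA(5) fB(5)] and C' = compositum_props[OF fA'(5) fB'(5)]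
  have KC': "K \<subseteq> compositum A' B'" using fA'(2) C'(2) by (rule order_trans)
  note mono = compositum_mono[OF sub fA(5) fB(5)]
  have "stable (compositum A' B') (compositum A B)"
    using stable_compositum[OF fA'(5) fB'(5) fA(5) fB(5)]
      normal_extD(4)[OF A'(2) fA'(2)] normal_extD(4)[OF B'(2) fB'(2)] by simp
  hence n: "normal_ext (compositum A' B') (compositum A B)"
    by (rule normal_extI[OF C'(1) KC' C(1) mono])
  have "compositum A' B' \<subseteq> N" if N: "intermediate_field K (compositum A B) N" "normal_ext N (compositum A B)" for N
  proof -
    have N': "subfield N R" "K \<subseteq> N" using N(1) unfolding intermediate_field_def by auto
    note st = normal_extD(4)[OF N(2) N'(2)]
    have "stable (N \<inter> A) A" by (rule stable_left_component[OF A B N' st])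
    moreover have "stable (N \<inter> B) B"
      using S.stable_left_component[OF B A N'] st by (simp add: compositum_commute)
    moreover have IA: "subfield (N \<inter> A) R" "K \<subseteq> N \<inter> A" and IB: "subfield (N \<inter> B) R" "K \<subseteq> N \<inter> B"
      using subfield_Int N' fA(1,2) fB(1,2) by auto
    ultimately have "normal_ext (N \<inter> A) A" "normal_ext (N \<inter> B) B"
      using normal_extI[OF IA fA(1)] normal_extI[OF IB fB(1)] by auto
    moreover have "intermediate_field K A (N \<inter> A)" "intermediate_field K B (N \<inter> B)"
      unfolding intermediate_field_def using IA IB by auto
    ultimately have "A' \<subseteq> N \<inter> A" "B' \<subseteq> N \<inter> B"
      using lA lB unfolding least_normal_base_def by auto
    thus ?thesis using compositum_least[OF N'(1)] by simp
  qed
  thus ?thesis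
    unfolding least_normal_base_def intermediate_field_def using n C'(1) KC' mono by simp
qed

text \<open>Half of the upper bound: only the factor \<open>L\<close> is cut down to
  \<open>F\<close>, by showing that the coordinates of elements of \<open>G\<close> lie in
  \<open>F0\<close>.\<close>

lemma normal_subext_in_left:
  assumes L: "finite_intermediate K P L" and J: "finite_intermediate K Q J"
    and A: "intermediate_field K L A" and B: "intermediate_field K J B"
    and F: "largest_normal_subext A L F"
    and G: "intermediate_field (compositum A B) (compositum L J) G" "normal_ext (compositum A B) G"
  shows "G \<subseteq> compositum F J"
proof -
  note fL = finite_intermediateD[OF L] and fJ = finite_intermediateD[OF J]
  note A' = finite_intermediate_sub(1)[OF L A]
  note fA = finite_intermediateD[OF A'] and fB = finite_intermediateD[OF finite_intermediate_sub(1)[OF J B]]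
  have AL: "A \<subseteq> L" and BJ: "B \<subseteq> J" using A B unfolding intermediate_field_def by auto
  have F': "subfield F R" "A \<subseteq> F" "F \<subseteq> L" using F unfolding largest_normal_subext_def intermediate_field_def by auto
  have Fc: "F \<subseteq> carrier R" using subfieldE(3)[OF F'(1)] .
  note AJ = compositum_props[OF fA(5) fJ(5)]
  have KAJ: "K \<subseteq> compositum A J" using fA(2) AJ(2) by (rule order_trans)
  \<comment> \<open>Quantifying over all automorphisms makes \<open>F0\<close> stable over
    \<open>compositum A J\<close>, since these compose; it is stable over \<open>L\<close> because
    it is contained in \<open>L\<close>.\<close>
  define F0 where "F0 = { x \<in> L. \<forall>\<rho> \<in> Gal (compositum A J). \<rho> x \<in> L }"
  note subL = subfieldE(1)[OF fL(1)]
  have F0L: "F0 \<subseteq> L" unfolding F0_def by auto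
  have AF0: "A \<subseteq> F0"
  proof
    fix a assume a: "a \<in> A"
    have aL: "a \<in> L" using a AL by auto
    have "\<rho> a \<in> L" if "\<rho> \<in> Gal (compositum A J)" for \<rho>
      unfolding Gal_fixes[OF that subsetD[OF AJ(2) a]] by (rule aL)
    thus "a \<in> F0" unfolding F0_def using aL by auto
  qed
  have "subring F0 R"
  proof (rule subringI)
    show "F0 \<subseteq> carrier R" using F0L fL(5) by (rule order_trans)
    show "\<one> \<in> F0" using AF0 subringE(3)[OF subfieldE(1)[OF fA(1)]] by (rule subsetD)
    fix h assume h: "h \<in> F0"
    hence hL: "h \<in> L" "h \<in> carrier R" using F0L fL(5) by auto
    have "\<rho> (\<ominus> h) \<in> L" if \<rho>: "\<rho> \<in> Gal (compositum A J)" for \<rho>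
    proof -
      interpret \<rho>: ring_hom_ring R R \<rho> by (rule Gal_hom[OF \<rho>])
      have "\<rho> h \<in> L" using h \<rho> unfolding F0_def by simp
      thus ?thesis using subringE(5)[OF subL] \<rho>.hom_a_inv[OF hL(2)] by simp
    qed
    thus "\<ominus> h \<in> F0" unfolding F0_def using subringE(5)[OF subL hL(1)] by simp
    fix h' assume h': "h' \<in> F0"
    hence hL': "h' \<in> L" "h' \<in> carrier R" using F0L fL(5) by auto
    have "\<rho> (h \<otimes> h') \<in> L \<and> \<rho> (h \<oplus> h') \<in> L" if \<rho>: "\<rho> \<in> Gal (compositum A J)" for \<rho>
    proof -
      interpret \<rho>: ring_hom_ring R R \<rho> by (rule Gal_hom[OF \<rho>])
      have "\<rho> h \<in> L" "\<rho> h' \<in> L" using h h' \<rho> unfolding F0_def by simp_all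
      thus ?thesis using subringE(6,7)[OF subL] \<rho>.hom_mult \<rho>.hom_add hL(2) hL'(2) by simp
    qed
    thus "h \<otimes> h' \<in> F0" "h \<oplus> h' \<in> F0"
      unfolding F0_def using subringE(6,7)[OF subL hL(1) hL'(1)] by simp_all
  qed
  hence F0: "subfield F0 R" using subring_imp_subfield order_trans[OF fA(2) AF0] by simp
  have "stable (compositum A J) F0"
    unfolding stable_def
  proof (intro ballI image_subsetI)
    fix \<tau> x assume \<tau>: "\<tau> \<in> Gal (compositum A J)" and x: "x \<in> F0"
    have "\<rho> (\<tau> x) \<in> L" if "\<rho> \<in> Gal (compositum A J)" for \<rho>
      using Gal_comp[OF \<tau> that] x unfolding F0_def by fastforce
    thus "\<tau> x \<in> F0" using x \<tau> unfolding F0_def by simp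
  qed
  moreover have "stable L F0"
    unfolding stable_def
  proof (intro ballI image_subsetI)
    fix \<tau> x assume "\<tau> \<in> Gal L" "x \<in> F0"
    thus "\<tau> x \<in> F0" using Gal_fixes[of \<tau> L x] F0L by auto
  qed
  ultimately have "stable (compositum A J \<inter> L) F0"
    using stable_Int[OF AJ(1) KAJ fL(1,2)] subfieldE(3)[OF F0] by simp
  moreover have "compositum A J \<inter> L = A"
    using compositum_Int(1)[OF A' J] AL fL(3) AJ(2) by blast
  ultimately have "normal_ext A F0" using normal_extI[OF fA(1,2) F0 AF0] by simp
  hence F0F: "F0 \<subseteq> F"
    using F F0 AF0 F0L unfolding largest_normal_subext_def intermediate_field_def by simp
  obtain n where "dimension n K J" using fJ(4) unfolding finite_dimension_def by blast
  then obtain Vs where Vs: "set Vs \<subseteq> carrier R" "independent K Vs" "Span K Vs = J"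
    using exists_base[OF subfield_axioms] by blast
  have VJ: "set Vs \<subseteq> J" using Span_base_incl[OF subfield_axioms Vs(1)] Vs(3) by simp
  have LJ: "compositum L J = Span L Vs"
    using compositum_eq_Span[OF fJ(1,2) fL(1,2) Vs(1,3)] by (simp add: compositum_commute)
  have "linearly_disjoint K Q P" using linearly_disjoint_sym[OF P(1,2) Q(1,2) disjoint] .
  hence ind: "independent P Vs" using Vs(2) order_trans[OF VJ fJ(3)] unfolding linearly_disjoint_def by simp
  have ABAJ: "compositum A B \<subseteq> compositum A J" by (rule compositum_mono[OF order_refl BJ fA(5) fJ(5)])
  have KAB: "K \<subseteq> compositum A B"
    using order_trans[OF fA(2)] compositum_props(2)[OF fA(5) fB(5)] by simp
  have GLJ: "G \<subseteq> Span L Vs" using G(1) LJ unfolding intermediate_field_def by simp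
  note FJ = compositum_props[OF Fc fJ(5)]
  show ?thesis
  proof
    fix x assume x: "x \<in> G"
    obtain ls where ls: "set ls \<subseteq> L" "length ls = length Vs" "x = combine ls Vs"
      using Span_mem_iff_length_version[OF fL(1) Vs(1)] subsetD[OF GLJ x] by auto
    have "set ls \<subseteq> F0"
    proof
      fix l assume l: "l \<in> set ls"
      have "\<rho> l \<in> L" if \<rho>: "\<rho> \<in> Gal (compositum A J)" for \<rho>
      proof -
        interpret \<rho>: ring_hom_ring R R \<rho> by (rule Gal_hom[OF \<rho>])
        have "\<rho> x \<in> G"
          using stableD[OF normal_extD(4)[OF G(2) KAB] subsetD[OF Gal_antimono[OF ABAJ] \<rho>] x] .
        then obtain ls' where ls': "set ls' \<subseteq> L" "length ls' = length Vs" "\<rho> x = combine ls' Vs"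
          using Span_mem_iff_length_version[OF fL(1) Vs(1)] GLJ by (meson subsetD)
        \<comment> \<open>As \<open>\<rho>\<close> fixes \<open>J\<close>, it acts on
          \<open>x\<close> through its coordinates. A priori their images lie only in
          \<open>P\<close>; uniqueness of coordinates over \<open>P\<close> identifies them with the
          coordinates in \<open>L\<close> of \<open>\<rho> x\<close>.\<close>
        have "map \<rho> Vs = Vs"
          by (rule map_idI, rule Gal_fixes[OF \<rho>]) (use VJ AJ(3) in auto)
        hence eq: "\<rho> x = combine (map \<rho> ls) Vs"
          using \<rho>.combine_hom[of ls Vs] ls(1,3) order_trans[OF ls(1) fL(5)] Vs(1) by simp
        have mP: "set (map \<rho> ls) \<subseteq> P"
        proof
          fix y assume "y \<in> set (map \<rho> ls)"
          then obtain z where z: "z \<in> set ls" "y = \<rho> z" by auto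
          have "z \<in> P" using z(1) ls(1) fL(3) by (simp add: subset_iff)
          thus "y \<in> P" using stableD[OF stable_mono[OF P(3) KAJ] \<rho>] z(2) by simp
        qed
        have lP: "set ls' \<subseteq> P" using order_trans[OF ls'(1) fL(3)] .
        have "\<rho> x \<in> Span P Vs" using Span_mem_iff_length_version[OF P(1) Vs(1)] lP ls'(2,3) by auto
        from unique_decomposition[OF P(1) ind this] have "map \<rho> ls = ls'"
          using mP lP ls(2) ls'(2,3) eq by (metis length_map)
        thus ?thesis using l ls'(1) by (auto simp: subset_iff)
      qed
      thus "l \<in> F0" unfolding F0_def using l ls(1) by auto
    qed
    hence "set ls \<subseteq> compositum F J" using F0F FJ(2) by (meson order_trans)
    moreover have "set Vs \<subseteq> compositum F J" using VJ FJ(3) by (rule order_trans)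
    ultimately show "x \<in> compositum F J"
      unfolding ls(3) by (rule combine_in_subring[OF subfieldE(1)[OF FJ(1)]])
  qed
qed

lemma largest_normal_subext_compositum:
  assumes L: "finite_intermediate K P L" and J: "finite_intermediate K Q J"
    and A: "intermediate_field K L A" and B: "intermediate_field K J B"
    and F: "largest_normal_subext A L F" and F': "largest_normal_subext B J F'"
  shows "largest_normal_subext (compositum A B) (compositum L J) (compositum F F')"
proof -
  interpret S: disjoint_normal_pair R K Q P by (rule swap)
  note fL = finite_intermediateD[OF L] and fJ = finite_intermediateD[OF J]
  note fA = finite_intermediateD[OF finite_intermediate_sub(1)[OF L A]]
    and fB = finite_intermediateD[OF finite_intermediate_sub(1)[OF J B]]
  have AF: "subfield F R" "A \<subseteq> F" "F \<subseteq> L" "normal_ext A F"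
    and BF: "subfield F' R" "B \<subseteq> F'" "F' \<subseteq> J" "normal_ext B F'"
    using F F' unfolding largest_normal_subext_def intermediate_field_def by auto
  have KF: "intermediate_field K L F"
    unfolding intermediate_field_def using AF(1,3) order_trans[OF fA(2) AF(2)] by simp
  note fF = finite_intermediate_sub(1)[OF L KF]
  have Fc: "F \<subseteq> carrier R" "F' \<subseteq> carrier R" using subfieldE(3)[OF AF(1)] subfieldE(3)[OF BF(1)] .
  note C = compositum_props[OF fA(5) fB(5)] and CF = compositum_props[OF Fc]
  have KC: "K \<subseteq> compositum A B" using fA(2) C(2) by (rule order_trans)
  have sub: "compositum A B \<subseteq> compositum F F'" "compositum F F' \<subseteq> compositum L J"
    using compositum_mono AF(2,3) BF(2,3) Fc fL(5) fJ(5) by auto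
  have "stable (compositum A B) (compositum F F')"
    using stable_compositum[OF fA(5) fB(5) Fc] normal_extD(4)[OF AF(4) fA(2)] normal_extD(4)[OF BF(4) fB(2)] .
  hence n: "normal_ext (compositum A B) (compositum F F')" by (rule normal_extI[OF C(1) KC CF(1) sub(1)])
  have "G \<subseteq> compositum F F'"
    if G: "intermediate_field (compositum A B) (compositum L J) G" "normal_ext (compositum A B) G" for G
  proof -
    have "G \<subseteq> compositum F J" by (rule normal_subext_in_left[OF L J A B F G])
    \<comment> \<open>Second application with the roles exchanged and \<open>F\<close> in place of
      \<open>L\<close>, now cutting \<open>J\<close> down to \<open>F'\<close>.\<close>
    hence "intermediate_field (compositum B A) (compositum J F) G"
      using G(1) unfolding intermediate_field_def by (simp add: compositum_commute)
    moreover have "intermediate_field K F A"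
      unfolding intermediate_field_def using fA(1,2) AF(2) by simp
    ultimately have "G \<subseteq> compositum F' F"
      using S.normal_subext_in_left[OF J fF B _ F'] G(2) by (simp add: compositum_commute)
    thus ?thesis by (simp add: compositum_commute)
  qed
  thus ?thesis unfolding largest_normal_subext_def intermediate_field_def using n sub CF(1) by simp
qed

end

section \<open>Normal chains\<close>

text \<open>Allows the padded sequences written with \<open>min\<close> to be replaced by the case
  distinctions of the theorem.\<close>

lemma (in ring) normal_descending_chain_cong:
  assumes "normal_descending_chain K E k N" "\<And>i. i \<le> k \<Longrightarrow> N' i = N i"
  shows "normal_descending_chain K E k N'"
  using assms unfolding normal_descending_chain_def by auto

lemma (in ring) normal_ascending_chain_cong:
  assumes "normal_ascending_chain K E k F" "\<And>i. i \<le> k \<Longrightarrow> F' i = F i"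
  shows "normal_ascending_chain K E k F'"
  using assms unfolding normal_ascending_chain_def by auto

context algebraic_closure_over
begin

text \<open>The intersected family contains \<open>carrier R\<close>, so it is nonempty, and
  stability passes to intersections.\<close>

lemma normal_closure_props:
  assumes "E \<subseteq> carrier R"
  shows "subfield (normal_closure K E) R" "K \<subseteq> normal_closure K E" "E \<subseteq> normal_closure K E"
    "stable K (normal_closure K E)"
proof -
  let ?S = "{ N. normal_ext K N \<and> E \<subseteq> N }"
  have "stable K (carrier R)" unfolding stable_def using Gal_closed by auto
  hence "normal_ext K (carrier R)"
    by (rule normal_extI[OF subfield_axioms order_refl carrier_is_subfield subfieldE(3)[OF subfield_axioms]])
  hence ne: "?S \<noteq> {}" using assms by auto
  have S: "subfield N R" "K \<subseteq> N" "stable K N" if "N \<in> ?S" for N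
    using normal_extD(2-4)[OF _ order_refl, of N] that by auto
  show "subfield (normal_closure K E) R"
    unfolding normal_closure_def using subfield_Inter[OF ne] S(1) by simp
  show "K \<subseteq> normal_closure K E" "E \<subseteq> normal_closure K E"
    unfolding normal_closure_def using S(2) by auto
  show "stable K (normal_closure K E)"
    unfolding stable_def normal_closure_def
  proof (intro ballI image_subsetI InterI)
    fix \<tau> x N assume \<tau>: "\<tau> \<in> Gal K" and x: "x \<in> \<Inter>?S" and N: "N \<in> ?S"
    show "\<tau> x \<in> N" using stableD[OF S(3)[OF N] \<tau>] InterD[OF x N] .
  qed
qed

lemma finite_intermediate_imp_finite_field_ext:
  assumes "finite_intermediate K P A" shows "finite_field_ext K A"
  unfolding finite_field_ext_def using finite_intermediateD[OF assms] subfield_axioms by simp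

text \<open>Chains are continued constantly beyond their last index, which unifies the cases of the theorem.\<close>

lemma normal_descending_chain_padded:
  assumes fin: "finite_intermediate K P E" and chain: "normal_descending_chain K E k N"
  shows "finite_intermediate K P (N (min i k))"
    and "least_normal_base K (N (min i k)) (N (min (Suc i) k))"
proof -
  have step: "finite_intermediate K P (N i) \<Longrightarrow> least_normal_base K (N i) (N (Suc i))" if "i < k" for i
    using chain that unique_max_normal_over_iff[OF finite_intermediate_imp_finite_field_ext]
    unfolding normal_descending_chain_def by metis
  have "i \<le> k \<Longrightarrow> finite_intermediate K P (N i)" for i
  proof (induction i)
    case 0 thus ?case using fin chain unfolding normal_descending_chain_def by simp
  next
    case (Suc i)
    hence "intermediate_field K (N i) (N (Suc i))"
      using step[of i] unfolding least_normal_base_def by simp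
    thus ?case using finite_intermediate_sub(1) Suc by simp
  qed
  hence fin_i: "finite_intermediate K P (N (min i k))" for i by simp
  show "finite_intermediate K P (N (min i k))" by (rule fin_i)
  show "least_normal_base K (N (min i k)) (N (min (Suc i) k))"
  proof (cases "i < k")
    case True thus ?thesis using step[OF True] fin_i[of i] by simp
  next
    \<comment> \<open>From index \<open>k\<close> on both entries are \<open>N k\<close>, and the
      stopping condition says that \<open>N k\<close> is its own least base.\<close>
    case False
    have Nk: "subfield (N k) R" "K \<subseteq> N k" using finite_intermediateD(1,2)[OF fin_i[of k]] by simp_all
    have "normal_ext (N k) (N k)" by (rule normal_extI[OF Nk Nk(1) order_refl stable_self])
    moreover have "intermediate_field K (N k) (N k)" unfolding intermediate_field_def using Nk by simp
    moreover have "\<forall>N'. intermediate_field K (N k) N' \<and> normal_ext N' (N k) \<longrightarrow> N' = N k"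
      using chain unfolding normal_descending_chain_def by simp
    ultimately have "least_normal_base K (N k) (N k)" unfolding least_normal_base_def by auto
    thus ?thesis using False by simp
  qed
qed

text \<open>Unlike in the descending case, the base field moves with \<open>j\<close> while
  \<open>E\<close> stays. The stopping condition is literally the claim for the constant
  continuation.\<close>

lemma normal_ascending_chain_padded:
  assumes fin: "finite_intermediate K P E" and chain: "normal_ascending_chain K E l F"
  shows "intermediate_field K E (F (min j l))"
    and "largest_normal_subext (F (min j l)) E (F (min (Suc j) l))"
proof -
  have "j \<le> l \<Longrightarrow> intermediate_field K E (F j)" for j
  proof (induction j)
    case 0 thus ?case
      using chain finite_intermediateD(2)[OF fin] subfield_axioms
      unfolding normal_ascending_chain_def intermediate_field_def by simp
  next
    case (Suc j)
    hence "intermediate_field (F j) E (F (Suc j))"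
      using chain unfolding normal_ascending_chain_def largest_normal_subext_def by simp
    thus ?case using Suc unfolding intermediate_field_def by auto
  qed
  thus "intermediate_field K E (F (min j l))" by simp
  show "largest_normal_subext (F (min j l)) E (F (min (Suc j) l))"
    using chain unfolding normal_ascending_chain_def by (cases "j < l") simp_all
qed

end

context disjoint_normal_pair
begin

text \<open>Each factor is recovered by intersecting with \<open>P\<close> or \<open>Q\<close>; this
  gives strictness of the composite chains.\<close>

lemma compositum_inject:
  assumes "finite_intermediate K P A" "finite_intermediate K Q B"
    and "finite_intermediate K P A'" "finite_intermediate K Q B'"
    and "compositum A B = compositum A' B'"
  shows "A = A'" "B = B'"
  using compositum_Int[OF assms(1,2)] compositum_Int[OF assms(3,4)] assms(5) by simp_all

lemma normal_descending_chain_compositum: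
  assumes L: "finite_intermediate K P L" and J: "finite_intermediate K Q J"
    and M: "finite_field_ext K (compositum L J)"
    and N: "normal_descending_chain K L k N" and N': "normal_descending_chain K J k' N'"
  shows "normal_descending_chain K (compositum L J) (max k k')
    (\<lambda>i. compositum (N (min i k)) (N' (min i k')))"
proof -
  let ?c = "\<lambda>i. compositum (N (min i k)) (N' (min i k'))"
  note a = normal_descending_chain_padded[OF L N] and b = normal_descending_chain_padded[OF J N']
  have least: "least_normal_base K (?c i) (?c (Suc i))" for i
    by (rule least_normal_base_compositum[OF a(1) b(1) a(2) b(2)])
  have sub: "?c (Suc i) \<subseteq> ?c i" for i
    using least[of i] unfolding least_normal_base_def intermediate_field_def by simp
  have c0: "?c 0 = compositum L J"
    using N N' unfolding normal_descending_chain_def by simp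
  \<comment> \<open>Finiteness is what permits the return from least bases to maximal
    degrees.\<close>
  have fin: "finite_field_ext K (?c i)" for i
  proof (induction i)
    case 0 thus ?case using M c0 by simp
  next
    case (Suc i)
    have fi: "finite_intermediate K (?c i) (?c i)"
      using Suc unfolding finite_field_ext_def finite_intermediate_def intermediate_field_def by simp
    have "intermediate_field K (?c i) (?c (Suc i))" using least[of i] unfolding least_normal_base_def by simp
    thus ?case using finite_intermediate_imp_finite_field_ext finite_intermediate_sub(1)[OF fi] by blast
  qed
  have "?c (Suc i) \<noteq> ?c i" if i: "i < max k k'" for i
  proof
    assume "?c (Suc i) = ?c i"
    hence eq: "N (min (Suc i) k) = N (min i k)" "N' (min (Suc i) k') = N' (min i k')"
      using compositum_inject[OF a(1) b(1) a(1) b(1)] by blast+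
    \<comment> \<open>Below the maximum at least one of the two chains is still strictly
      decreasing.\<close>
    from i consider "i < k" | "i < k'" by linarith
    thus False
    proof cases
      case 1 thus ?thesis using eq(1) N unfolding normal_descending_chain_def by auto
    next
      case 2 thus ?thesis using eq(2) N' unfolding normal_descending_chain_def by auto
    qed
  qed
  hence "?c (Suc i) \<subset> ?c i" if "i < max k k'" for i using sub[of i] that by blast
  moreover have "unique_max_normal_over K (?c i) (?c (Suc i))" for i
    using unique_max_normal_over_iff[OF fin] least by blast
  moreover have "N0 = ?c (max k k')"
    if "intermediate_field K (?c (max k k')) N0" "normal_ext N0 (?c (max k k'))" for N0
  proof
    show "N0 \<subseteq> ?c (max k k')" using that(1) unfolding intermediate_field_def by simp
    \<comment> \<open>Past the last index the sequence is constant, so its last field is its own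
      least base: the stopping condition.\<close>
    have "?c (Suc (max k k')) = ?c (max k k')" by (simp add: min_def)
    thus "?c (max k k') \<subseteq> N0" using least[of "max k k'"] that unfolding least_normal_base_def by metis
  qed
  ultimately show ?thesis unfolding normal_descending_chain_def using c0 by blast
qed

lemma normal_ascending_chain_compositum:
  assumes L: "finite_intermediate K P L" and J: "finite_intermediate K Q J"
    and F: "normal_ascending_chain K L l F" and F': "normal_ascending_chain K J l' F'"
  shows "normal_ascending_chain K (compositum L J) (max l l')
    (\<lambda>j. compositum (F (min j l)) (F' (min j l')))"
proof -
  let ?c = "\<lambda>j. compositum (F (min j l)) (F' (min j l'))"
  note a = normal_ascending_chain_padded[OF L F] and b = normal_ascending_chain_padded[OF J F']
  note fa = finite_intermediate_sub(1)[OF L a(1)] and fb = finite_intermediate_sub(1)[OF J b(1)]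
  have largest: "largest_normal_subext (?c j) (compositum L J) (?c (Suc j))" for j
    by (rule largest_normal_subext_compositum[OF L J a(1) b(1) a(2) b(2)])
  have sub: "?c j \<subseteq> ?c (Suc j)" for j
    using largest[of j] unfolding largest_normal_subext_def intermediate_field_def by simp
  have "?c j \<noteq> ?c (Suc j)" if j: "j < max l l'" for j
  proof
    assume "?c j = ?c (Suc j)"
    hence eq: "F (min j l) = F (min (Suc j) l)" "F' (min j l') = F' (min (Suc j) l')"
      using compositum_inject[OF fa fb fa fb] by blast+
    from j consider "j < l" | "j < l'" by linarith
    thus False
    proof cases
      case 1 thus ?thesis using eq(1) F unfolding normal_ascending_chain_def by auto
    next
      case 2 thus ?thesis using eq(2) F' unfolding normal_ascending_chain_def by auto
    qed
  qed
  hence "?c j \<subset> ?c (Suc j)" if "j < max l l'" for j using sub[of j] that by blast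
  moreover have "?c (Suc (max l l')) = ?c (max l l')" by (simp add: min_def)
  hence "largest_normal_subext (?c (max l l')) (compositum L J) (?c (max l l'))"
    using largest[of "max l l'"] by metis
  moreover have "?c 0 = K"
  proof -
    have "?c 0 = compositum K K" using F F' unfolding normal_ascending_chain_def by simp
    thus ?thesis
      using compositum_least[OF subfield_axioms order_refl order_refl]
        compositum_props(2)[OF subfieldE(3)[OF subfield_axioms] subfieldE(3)[OF subfield_axioms]] by simp
  qed
  ultimately show ?thesis unfolding normal_ascending_chain_def using largest by blast
qed

end

section \<open>Specialization to the normal closures of the two extensions\<close>

theorem proposition3p18:
  fixes Kbar :: "('a, 'b) ring_scheme" and K L J M :: "'a set"
  assumes "algebraic_closure Kbar K"
    and "ring.general_normal_magnification Kbar K L J M"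
  shows
    "(\<forall>k k' N N'.
        ring.normal_descending_chain Kbar K L k N \<and>
        ring.normal_descending_chain Kbar K J k' N' \<longrightarrow>
        (k' \<le> k \<longrightarrow>
           ring.normal_descending_chain Kbar K M k
             (\<lambda>i. if i \<le> k' then ring.compositum Kbar (N i) (N' i)
                  else ring.compositum Kbar (N i) (N' k'))) \<and>
        (k < k' \<longrightarrow>
           ring.normal_descending_chain Kbar K M k'
             (\<lambda>i. if i \<le> k then ring.compositum Kbar (N i) (N' i)
                  else ring.compositum Kbar (N k) (N' i)))) \<and>
     (\<forall>l l' F F'.
        ring.normal_ascending_chain Kbar K L l F \<and>
        ring.normal_ascending_chain Kbar K J l' F' \<longrightarrow>
        (l' \<le> l \<longrightarrow>
           ring.normal_ascending_chain Kbar K M l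
             (\<lambda>j. if j \<le> l' then ring.compositum Kbar (F j) (F' j)
                  else ring.compositum Kbar (F j) (F' l'))) \<and>
        (l < l' \<longrightarrow>
           ring.normal_ascending_chain Kbar K M l'
             (\<lambda>j. if j \<le> l then ring.compositum Kbar (F j) (F' j)
                  else ring.compositum Kbar (F l) (F' j))))"
proof -
  interpret algebraic_closure_over Kbar K using assms(1) by (rule algebraic_closure_over.intro)
  let ?P = "normal_closure K L" and ?Q = "normal_closure K J"
  have M: "finite_field_ext K (compositum L J)" "compositum L J = M"
    and L: "finite_field_ext K L" and J: "finite_field_ext K J" and disj: "linearly_disjoint K ?P ?Q"
    using assms(2) unfolding general_normal_magnification_def by auto
  have Lc: "L \<subseteq> carrier Kbar" and Jc: "J \<subseteq> carrier Kbar"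
    using L J subfieldE(3) unfolding finite_field_ext_def by auto
  note clL = normal_closure_props[OF Lc] and clJ = normal_closure_props[OF Jc]
  interpret disjoint_normal_pair Kbar K ?P ?Q
    by (intro disjoint_normal_pair.intro disjoint_normal_pair_axioms.intro algebraic_closure_over_axioms
        clL(1,2,4) clJ(1,2,4) disj)
  have L': "finite_intermediate K ?P L" and J': "finite_intermediate K ?Q J"
    using L J clL(3) clJ(3)
    unfolding finite_intermediate_def intermediate_field_def finite_field_ext_def by simp_all
  note desc = normal_descending_chain_compositum[OF L' J' M(1), unfolded M(2)]
  note asc = normal_ascending_chain_compositum[OF L' J', unfolded M(2)]
  show ?thesis
  proof (intro conjI allI impI; elim conjE)
    fix k k' N N'
    assume N: "normal_descending_chain K L k N" "normal_descending_chain K J k' N'"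
    show "normal_descending_chain K M k
        (\<lambda>i. if i \<le> k' then compositum (N i) (N' i) else compositum (N i) (N' k'))" if "k' \<le> k"
      \<comment> \<open>For \<open>i \<le> k\<close> the index \<open>min i k\<close> is
        \<open>i\<close>, and \<open>min i k'\<close> produces the two branches.\<close>
      using normal_descending_chain_cong[OF desc[OF N, unfolded max_absorb1[OF that]]] by (simp add: min_def)
    show "normal_descending_chain K M k'
        (\<lambda>i. if i \<le> k then compositum (N i) (N' i) else compositum (N k) (N' i))" if "k < k'"
      using normal_descending_chain_cong[OF desc[OF N, unfolded max_absorb2[OF less_imp_le[OF that]]]]
      by (simp add: min_def)
  next
    fix l l' F F'
    assume F: "normal_ascending_chain K L l F" "normal_ascending_chain K J l' F'"
    show "normal_ascending_chain K M l
        (\<lambda>j. if j \<le> l' then compositum (F j) (F' j) else compositum (F j) (F' l'))" if "l' \<le> l"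
      using normal_ascending_chain_cong[OF asc[OF F, unfolded max_absorb1[OF that]]] by (simp add: min_def)
    show "normal_ascending_chain K M l'
        (\<lambda>j. if j \<le> l then compositum (F j) (F' j) else compositum (F l) (F' j))" if "l < l'"
      using normal_ascending_chain_cong[OF asc[OF F, unfolded max_absorb2[OF less_imp_le[OF that]]]]
      by (simp add: min_def)
  qed
qed

end
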